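(* Let $\mathcal B$ be a separable complex Banach space, $U\subset\mathbb C$ open and connected, $A:U\to\mathcal L_{\mathcal B}$ a holomorphic Fredholm operator pencil, and $z_0\in\sigma(A)$ an isolated element of $\sigma(A)$. Let $A(z)=\sum_{j\ge 0}A_j(z-z_0)^j$ be the Taylor series of $A$ around $z_0$ and let $$A(z)^{-1}=\sum_{j=-m}^{\infty}N_j(z-z_0)^j,\qquad 1\le m<\infty,\ N_{-m}\neq 0,$$ be the Laurent series of the inverse in a punctured neighborhood of $z_0$. Put $\mathrm R_0=\operatorname{ran}A_0$, $\mathrm K_0=\ker A_0$, $\mathrm K_1=\{x\in\mathrm K_0: A_1x\in\mathrm R_0\}$ and $\mathrm R_1=\operatorname{ran}A_0+A_1\ker A_0$, and suppose that $\mathrm K_1\neq\{0\}$. Then the following conditions are equivalent: (i) $m=2$. (ii) For some choice of complementary subspaces $\mathrm R_0^c$ of $\mathrm R_0$ and $\mathrm K_0^c$ of $\mathrm K_0$, $$\mathcal B=\mathrm R_1\oplus A^{\dagger}_{2\,\{\mathrm R_0^c,\mathrm K_0^c\}}\mathrm K_1.$$ (iii) For all possible choices of complementary subspaces $\mathrm R_0^c$ of $\mathrm R_0$, $\mathrm K_0^c$ of $\mathrm K_0$ and $\mathrm R_1^c$ of $\mathrm R_1$ satisfying $\mathrm R_1^c\subset\mathrm R_0^c$, the map $S^{\dagger}_{\{\mathrm R_0^c,\mathrm K_0^c,\mathrm R_1^c\}}:\mathrm K_1\to\mathrm R_1^c$ is invertible. (iv) For some choice of complementary subspaces $\mathrm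 R_0^c$ of $\mathrm R_0$, $\mathrm K_0^c$ of $\mathrm K_0$ and $\mathrm R_1^c$ of $\mathrm R_1$ satisfying $\mathrm R_1^c\subset\mathrm R_0^c$, the map $S^{\dagger}_{\{\mathrm R_0^c,\mathrm K_0^c,\mathrm R_1^c\}}:\mathrm K_1\to\mathrm R_1^c$ is invertible. Moreover, under any of these conditions and for any choice of complementary subspaces $\mathrm R_0^c$, $\mathrm K_0^c$, $\mathrm R_1^c$, $\mathrm K_1^c$ satisfying $\mathrm R_1^c\subset\mathrm R_0^c$ (where $\mathrm K_1^c$ is a complementary subspace of $\mathrm K_1$ in $\mathrm K_0$), the coefficients $(N_j,\ j\ge -2)$ are given by the following recursive formula. Writing $A_0^g=(A_0)^g_{\{\mathrm R_0^c,\mathrm K_0^c\}}$, $S^g=(S_{\mathrm R_0^c})^g_{\{\mathrm R_1^c,\mathrm K_1^c\}}$, $A_2^\dagger=A^\dagger_{2\,\{\mathrm R_0^c,\mathrm K_0^c\}}$, $$A_3^\dagger=A_3-A_1A_0^gA_1A_0^gA_1,\qquad Q^L=\mathrm{id}_{\mathcal B}-A_2^\dagger N_{-2},\qquad Q^R=\mathrm{id}_{\mathcal B}-N_{-2}A_2^\dagger,$$ one has $$N_{-2}=(S^\dagger_{\{\mathrm R_0^c,\mathrm K_0^c,\mathrm R_1^c\}})^{-1}\mathrm P_{\mathrm R_1^c},$$ $$N_{-1}=\big(Q^RS^g\mathrm P_{\mathrm R_0^c}-N_{-2}A_1A_0^g\big)Q^L-Q^RA_0^gA_1N_{-2}-N_{-2}A_3^\dagger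 N_{-2},$$ and, for $j\ge0$, $$N_j=\big(G_j(1,2)A_0^gA_1-G_j(2,2)\big)N_{-2}+\big(\mathbf 1_{j=0}-G_j(0,2)\big)A_0^g\big(\mathrm{id}_{\mathcal B}-A_1S^g\mathrm P_{\mathrm R_0^c}\big)Q^L-G_j(1,2)S^g\mathrm P_{\mathrm R_0^c}Q^L,$$ where each $N_j$ is understood as a map from $\mathcal B$ to $\mathcal B$.
   Context: $\mathcal L_{\mathcal B}$ is the Banach space of bounded linear operators on $\mathcal B$ with the operator norm. An operator $T\in\mathcal L_{\mathcal B}$ is Fredholm if $\ker T$ and $\mathcal B/\operatorname{ran}T$ are finite dimensional. A holomorphic Fredholm operator pencil on $U$ is a map $A:U\to\mathcal L_{\mathcal B}$, holomorphic in the operator norm topology, with $A(z)$ Fredholm for every $z\in U$. Its spectrum is $\sigma(A)=\{z\in U: A(z)\text{ is not invertible}\}$. By the analytic Fredholm theorem, $A(z)^{-1}$ exists in a punctured neighborhood of $z_0$ and has a pole of some finite order $m\ge1$ at $z_0$. Direct sums: $\mathcal B=V\oplus W$ means $V,W$ are closed subspaces with $V\cap W=\{0\}$ and $V+W=\mathcal B$; then $W$ is called a complementary subspace of $V$, denoted $V^c$ (not unique in general), and $\mathrm P_{V^c}$ denotes the bounded projection onto $V^c$ along $V$. Under the present hypotheses $\mathrm R_0,\mathrm K_0,\mathrm R_1$ admit complementary subspaces, and for any given $\mathrm R_0^c$ one can choose $\mathrm R_1^c\subset\mathrm R_0^c$. By contrast, $\mathrm K_1^c$ denotes a complementary subspace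 of $\mathrm K_1$ inside $\mathrm K_0$, i.e. $\mathrm K_0=\mathrm K_1\oplus\mathrm K_1^c$. Given complementary subspaces $\mathrm R_0^c$, $\mathrm K_0^c$, $\mathrm R_1^c\subset\mathrm R_0^c$, $\mathrm K_1^c$, define: - the generalized inverse of $A_0$: $(A_0)^g_{\{\mathrm R_0^c,\mathrm K_0^c\}}=(A_0|_{\mathrm K_0^c})^{-1}(\mathrm{id}_{\mathcal B}-\mathrm P_{\mathrm R_0^c})$, where $(A_0|_{\mathrm K_0^c})^{-1}$ is defined on $\mathrm R_0$; - $S_{\mathrm R_0^c}=\mathrm P_{\mathrm R_0^c}A_1|_{\mathrm K_0}:\mathrm K_0\to\mathrm R_0^c$, whose kernel is $\mathrm K_1$, and for which $\mathrm R_0^c=S_{\mathrm R_0^c}\mathrm K_0\oplus\mathrm R_1^c$; its generalized inverse is $(S_{\mathrm R_0^c})^g_{\{\mathrm R_1^c,\mathrm K_1^c\}}=(S_{\mathrm R_0^c}|_{\mathrm K_1^c})^{-1}(\mathrm{id}_{\mathcal B}-\mathrm P_{\mathrm R_1^c})|_{\mathrm R_0^c}$; - $A^{\dagger}_{2\,\{\mathrm R_0^c,\mathrm K_0^c\}}=A_2-A_1(A_0)^g_{\{\mathrm R_0^c,\mathrm K_0^c\}}A_1$; - $S^\dagger_{\{\mathrm R_0^c,\mathrm K_0^c,\mathrm R_1^c\}}=\mathrm P_{\mathrm R_1^c}A^{\dagger}_{2\,\{\mathrm R_0^c,\mathrm K_0^c\}}|_{\mathrm K_1}:\mathrm K_1\to\mathrm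 R_1^c$. Notation: $\mathbf 1_{j=0}=\mathrm{id}_{\mathcal B}$ if $j=0$ and $\mathbf 1_{j=0}=0$ otherwise; $G_j(\ell,m)=\sum_{k=-m}^{j-1}N_kA_{j+\ell-k}$ for $\ell=0,1,2,\ldots$. *)

theory Defs
  imports "HOL-Analysis.Analysis"
begin

section \<open>Complex Banach spaces\<close>

class complex_vector = real_vector +
  fixes scaleC :: "complex \<Rightarrow> 'a \<Rightarrow> 'a" (infixr \<open>*\<^sub>C\<close> 75)
  assumes scaleC_add_right: "a *\<^sub>C (x + y) = a *\<^sub>C x + a *\<^sub>C y"
    and scaleC_add_left: "(a + b) *\<^sub>C x = a *\<^sub>C x + b *\<^sub>C x"
    and scaleC_scaleC: "a *\<^sub>C b *\<^sub>C x = (a * b) *\<^sub>C x"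
    and scaleC_one: "1 *\<^sub>C x = x"
    and scaleR_scaleC: "r *\<^sub>R x = complex_of_real r *\<^sub>C x"

class complex_normed_vector = complex_vector + real_normed_vector +
  assumes norm_scaleC: "norm (a *\<^sub>C x) = cmod a * norm x"

class complex_banach = complex_normed_vector + banach

global_interpretation complex_vector: vector_space "scaleC :: complex \<Rightarrow> 'a \<Rightarrow> 'a :: complex_vector"
  by unfold_locales (simp_all add: scaleC_add_right scaleC_add_left scaleC_scaleC scaleC_one)

abbreviation csubspace :: "'a::complex_vector set \<Rightarrow> bool"
  where "csubspace \<equiv> complex_vector.subspace"

abbreviation cspan :: "'a::complex_vector set \<Rightarrow> 'a set"
  where "cspan \<equiv> complex_vector.span"

instantiation blinfun :: (real_normed_vector, complex_normed_vector) complex_normed_vector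
begin

lift_definition scaleC_blinfun :: "complex \<Rightarrow> 'a \<Rightarrow>\<^sub>L 'b \<Rightarrow> 'a \<Rightarrow>\<^sub>L 'b" is "\<lambda>c f x. c *\<^sub>C f x"
proof -
  fix c :: complex and f :: "'a \<Rightarrow> 'b"
  assume "bounded_linear f"
  then interpret bounded_linear f .
  obtain K where K: "\<And>x. norm (f x) \<le> norm x * K" using bounded by blast
  show "bounded_linear (\<lambda>x. c *\<^sub>C f x)"
  proof (rule bounded_linear_intro[where K = "cmod c * K"])
    show "c *\<^sub>C f (x + y) = c *\<^sub>C f x + c *\<^sub>C f y" for x y
      by (simp add: add scaleC_add_right)
    show "c *\<^sub>C f (r *\<^sub>R x) = r *\<^sub>R c *\<^sub>C f x" for r x
      by (simp add: scaleR scaleR_scaleC scaleC_scaleC mult.commute)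
    show "norm (c *\<^sub>C f x) \<le> norm x * (cmod c * K)" for x
      using mult_left_mono[OF K[of x], of "cmod c"] by (simp add: norm_scaleC mult_ac)
  qed
qed

instance
proof
  fix a b :: complex and r :: real and S T :: "'a \<Rightarrow>\<^sub>L 'b"
  show "a *\<^sub>C (S + T) = a *\<^sub>C S + a *\<^sub>C T"
    by transfer (simp add: scaleC_add_right)
  show "(a + b) *\<^sub>C S = a *\<^sub>C S + b *\<^sub>C S"
    by transfer (simp add: scaleC_add_left)
  show "a *\<^sub>C b *\<^sub>C S = (a * b) *\<^sub>C S"
    by transfer (simp add: scaleC_scaleC)
  show "1 *\<^sub>C S = S"
    by transfer (simp add: scaleC_one)
  show "r *\<^sub>R S = complex_of_real r *\<^sub>C S"
    by transfer (simp add: scaleR_scaleC)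
  have le: "norm (c *\<^sub>C R) \<le> cmod c * norm R" for c and R :: "'a \<Rightarrow>\<^sub>L 'b"
  proof (rule norm_blinfun_bound)
    show "norm (blinfun_apply (c *\<^sub>C R) x) \<le> cmod c * norm R * norm x" for x
      using mult_left_mono[OF norm_blinfun[of R x], of "cmod c"]
      by (simp add: scaleC_blinfun.rep_eq norm_scaleC mult.assoc)
  qed simp
  show "norm (a *\<^sub>C S) = cmod a * norm S"
  proof (cases "a = 0")
    case True
    then show ?thesis using le[of 0 S] by simp
  next
    case False
    have "inverse a *\<^sub>C a *\<^sub>C S = S"
      using False by (transfer) (simp add: scaleC_scaleC scaleC_one)
    then have "norm S \<le> cmod (inverse a) * norm (a *\<^sub>C S)"
      using le[of "inverse a" "a *\<^sub>C S"] by simp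
    then have "cmod a * norm S \<le> norm (a *\<^sub>C S)"
      using False by (simp add: norm_divide field_simps)
    with le[of a S] show ?thesis by simp
  qed
qed

end

instance blinfun :: (real_normed_vector, complex_banach) complex_banach ..

section \<open>Fredholm operator pencils\<close>

text \<open>The type \<^typ>\<open>'a \<Rightarrow>\<^sub>L 'a\<close> consists of the bounded \<^emph>\<open>real\<close>-linear operators; the complex Banach
  space of bounded complex-linear operators is the following closed subspace of it.\<close>

definition clinear_ops :: "('a::complex_normed_vector \<Rightarrow>\<^sub>L 'a) set"
  where "clinear_ops = {T. Vector_Spaces.linear scaleC scaleC (blinfun_apply T)}"

definition inverse_ops :: "('a::complex_normed_vector \<Rightarrow>\<^sub>L 'a) \<Rightarrow> ('a \<Rightarrow>\<^sub>L 'a) \<Rightarrow> bool"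
  where "inverse_ops T S \<longleftrightarrow> S \<in> clinear_ops \<and> T o\<^sub>L S = id_blinfun \<and> S o\<^sub>L T = id_blinfun"

definition invertible_op :: "('a::complex_normed_vector \<Rightarrow>\<^sub>L 'a) \<Rightarrow> bool"
  where "invertible_op T \<longleftrightarrow> (\<exists>S. inverse_ops T S)"

definition op_inverse :: "('a::complex_normed_vector \<Rightarrow>\<^sub>L 'a) \<Rightarrow> ('a \<Rightarrow>\<^sub>L 'a)"
  where "op_inverse T = (THE S. inverse_ops T S)"

definition finite_dim :: "'a::complex_vector set \<Rightarrow> bool"
  where "finite_dim V \<longleftrightarrow> (\<exists>F. finite F \<and> V = cspan F)"

text \<open>The quotient by \<open>V\<close> is spanned by the finitely many cosets \<open>f + V\<close>, \<open>f \<in> F\<close>.\<close>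

definition finite_codim :: "'a::complex_vector set \<Rightarrow> bool"
  where "finite_codim V \<longleftrightarrow> (\<exists>F. finite F \<and> (\<forall>x. \<exists>u\<in>cspan F. x - u \<in> V))"

definition op_kernel :: "('a::complex_normed_vector \<Rightarrow>\<^sub>L 'a) \<Rightarrow> 'a set"
  where "op_kernel T = {x. blinfun_apply T x = 0}"

definition fredholm_op :: "('a::complex_normed_vector \<Rightarrow>\<^sub>L 'a) \<Rightarrow> bool"
  where "fredholm_op T \<longleftrightarrow>
    T \<in> clinear_ops \<and> finite_dim (op_kernel T) \<and> finite_codim (range (blinfun_apply T))"

text \<open>As for \<^const>\<open>has_field_derivative\<close>, complex differentiability says that the real derivative is complex-linear; the library's \<^const>\<open>holomorphic_on\<close> covers only scalar-valued functions.\<close>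

definition vec_holomorphic_on :: "(complex \<Rightarrow> 'b::complex_normed_vector) \<Rightarrow> complex set \<Rightarrow> bool"
  where "vec_holomorphic_on f U \<longleftrightarrow>
    (\<forall>z\<in>U. \<exists>D. (f has_derivative (\<lambda>h. h *\<^sub>C D)) (at z within U))"

definition fredholm_pencil :: "(complex \<Rightarrow> ('a::complex_normed_vector \<Rightarrow>\<^sub>L 'a)) \<Rightarrow> complex set \<Rightarrow> bool"
  where "fredholm_pencil A U \<longleftrightarrow> vec_holomorphic_on A U \<and> (\<forall>z\<in>U. fredholm_op (A z))"

definition pencil_spectrum :: "(complex \<Rightarrow> ('a::complex_normed_vector \<Rightarrow>\<^sub>L 'a)) \<Rightarrow> complex set \<Rightarrow> complex set"
  where "pencil_spectrum A U = {z\<in>U. \<not> invertible_op (A z)}"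

definition has_taylor_series ::
    "(complex \<Rightarrow> 'b::complex_normed_vector) \<Rightarrow> complex \<Rightarrow> (nat \<Rightarrow> 'b) \<Rightarrow> bool"
  where "has_taylor_series f z\<^sub>0 a \<longleftrightarrow>
    (\<exists>r>0. \<forall>z\<in>ball z\<^sub>0 r. (\<lambda>j. (z - z\<^sub>0) ^ j *\<^sub>C a j) sums f z)"

text \<open>The series \<open>\<Sum>j\<ge>-m. (z - z\<^sub>0)\<^sup>j c\<^sub>j\<close>, with \<open>j = n - m\<close> for \<open>n \<ge> 0\<close>.\<close>

definition has_laurent_series ::
    "(complex \<Rightarrow> 'b::complex_normed_vector) \<Rightarrow> complex \<Rightarrow> nat \<Rightarrow> (int \<Rightarrow> 'b) \<Rightarrow> bool"
  where "has_laurent_series f z\<^sub>0 m c \<longleftrightarrow>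
    (\<exists>r>0. \<forall>z\<in>ball z\<^sub>0 r - {z\<^sub>0}.
      (\<lambda>n. (z - z\<^sub>0) powi (int n - int m) *\<^sub>C c (int n - int m)) sums f z)"

section \<open>Direct sums and projections\<close>

definition direct_sum :: "'a::complex_normed_vector set \<Rightarrow> 'a set \<Rightarrow> 'a set \<Rightarrow> bool"
  where "direct_sum E V W \<longleftrightarrow>
    csubspace V \<and> closed V \<and> csubspace W \<and> closed W \<and>
    V \<inter> W = {0} \<and> {v + w | v w. v \<in> V \<and> w \<in> W} = E"

abbreviation complementary :: "'a::complex_normed_vector set \<Rightarrow> 'a set \<Rightarrow> bool"
  where "complementary V W \<equiv> direct_sum UNIV V W"

text \<open>The projection onto \<open>W\<close> along \<open>V\<close>, for complementary \<open>V\<close> and \<open>W\<close>.\<close>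

definition proj_along :: "'a::complex_normed_vector set \<Rightarrow> 'a set \<Rightarrow> 'a \<Rightarrow> 'a"
  where "proj_along V W x = (THE w. w \<in> W \<and> x - w \<in> V)"

section \<open>Objects attached to the Taylor coefficients\<close>

text \<open>Throughout, \<open>A\<close> is the sequence of Taylor coefficients. Maps whose domain is a subspace are
  given by functions on the whole space; the inverse of the restriction of \<open>f\<close> to \<open>V\<close> is
  \<^term>\<open>the_inv_into V f\<close>.\<close>

context
  fixes A :: "nat \<Rightarrow> 'a::complex_normed_vector \<Rightarrow>\<^sub>L 'a"
begin

definition R0 :: "'a set"
  where "R0 = range (A 0)"

definition K0 :: "'a set"
  where "K0 = op_kernel (A 0)"

definition K1 :: "'a set"
  where "K1 = {x \<in> K0. A 1 x \<in> R0}"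

definition R1 :: "'a set"
  where "R1 = {u + v | u v. u \<in> R0 \<and> v \<in> A 1 ` K0}"

definition A0_ginv :: "'a set \<Rightarrow> 'a set \<Rightarrow> 'a \<Rightarrow> 'a"
  where "A0_ginv R0c K0c x = the_inv_into K0c (A 0) (x - proj_along R0 R0c x)"

definition S_map :: "'a set \<Rightarrow> 'a \<Rightarrow> 'a"
  where "S_map R0c x = proj_along R0 R0c (A 1 x)"

definition S_ginv :: "'a set \<Rightarrow> 'a set \<Rightarrow> 'a set \<Rightarrow> 'a \<Rightarrow> 'a"
  where "S_ginv R0c R1c K1c x = the_inv_into K1c (S_map R0c) (x - proj_along R1 R1c x)"

definition A2_dagger :: "'a set \<Rightarrow> 'a set \<Rightarrow> 'a \<Rightarrow> 'a"
  where "A2_dagger R0c K0c x = A 2 x - A 1 (A0_ginv R0c K0c (A 1 x))"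

definition A3_dagger :: "'a set \<Rightarrow> 'a set \<Rightarrow> 'a \<Rightarrow> 'a"
  where "A3_dagger R0c K0c x =
    A 3 x - A 1 (A0_ginv R0c K0c (A 1 (A0_ginv R0c K0c (A 1 x))))"

definition S_dagger :: "'a set \<Rightarrow> 'a set \<Rightarrow> 'a set \<Rightarrow> 'a \<Rightarrow> 'a"
  where "S_dagger R0c K0c R1c x = proj_along R1 R1c (A2_dagger R0c K0c x)"

text \<open>Every index \<open>j + l - k\<close> occurring in the sum is positive, so \<^const>\<open>nat\<close> is harmless.\<close>

definition G_sum :: "(int \<Rightarrow> 'a \<Rightarrow>\<^sub>L 'a) \<Rightarrow> int \<Rightarrow> nat \<Rightarrow> nat \<Rightarrow> 'a \<Rightarrow> 'a"
  where "G_sum N j l m x = (\<Sum>k = - int m..j - 1. N k (A (nat (j + int l - k)) x))"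

end

end

theory Submission
  imports Defs
begin

text \<open>
  Comparing coefficients in \<open>A(z) A(z)\<^sup>-\<^sup>1 = id = A(z)\<^sup>-\<^sup>1 A(z)\<close> gives two systems of linear relations
  between the \<open>A\<^sub>j\<close> and the \<open>N\<^sub>j\<close>, and everything else is algebra. If \<open>m \<ge> 2\<close>, then \<open>N\<^bsub>-m\<^esub>\<close> vanishes on
  \<open>R\<^sub>1\<close>, and on \<open>A\<^sub>2\<^sup>\<dagger> K\<^sub>1\<close> it vanishes for \<open>m \<ge> 3\<close> and inverts \<open>A\<^sub>2\<^sup>\<dagger>\<close> for \<open>m = 2\<close>. Hence a pole of
  order at least 3 is incompatible with \<open>R\<^sub>1 + A\<^sub>2\<^sup>\<dagger> K\<^sub>1 = B\<close>, whereas for \<open>m = 2\<close> every \<open>y\<close> splits as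
  \<open>(y - A\<^sub>2\<^sup>\<dagger> N\<^bsub>-2\<^esub> y) + A\<^sub>2\<^sup>\<dagger> N\<^bsub>-2\<^esub> y\<close>; evaluating \<open>N\<^sub>j\<close> on the two summands yields the recursion.
  The case \<open>m = 1\<close> is excluded by \<open>K\<^sub>1 \<noteq> {0}\<close>. Closed complements exist because \<open>id - N\<^sub>0 A\<^sub>0\<close> and \<open>id - A\<^sub>0 N\<^sub>0\<close> have
  finite rank.
\<close>

section \<open>Coefficients of the product of two operator-valued power series\<close>

lemma clinear_ops_scaleC:
  "T \<in> clinear_ops \<Longrightarrow> blinfun_apply T (c *\<^sub>C x) = c *\<^sub>C blinfun_apply T x"
  by (simp add: clinear_ops_def Vector_Spaces.linear_def module_hom_def module_hom_axioms_def)

lemma clinear_opsI: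
  "(\<And>c x. blinfun_apply T (c *\<^sub>C x) = c *\<^sub>C blinfun_apply T x) \<Longrightarrow> T \<in> clinear_ops"
  unfolding clinear_ops_def Vector_Spaces.linear_def module_hom_def module_hom_axioms_def
  by (auto simp: blinfun.add_right complex_vector.vector_space_axioms complex_vector.module_axioms)

lemma blinfun_compose_scaleC_left: "(c *\<^sub>C S) o\<^sub>L T = c *\<^sub>C (S o\<^sub>L T)"
  by (rule blinfun_eqI) (simp add: scaleC_blinfun.rep_eq)

lemma blinfun_compose_scaleC_right:
  "S \<in> clinear_ops \<Longrightarrow> S o\<^sub>L (c *\<^sub>C T) = c *\<^sub>C (S o\<^sub>L T)"
  by (rule blinfun_eqI) (simp add: scaleC_blinfun.rep_eq clinear_ops_scaleC)

lemma power_series_remainder: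
  fixes c :: "nat \<Rightarrow> 'b::complex_banach"
  assumes "r > 0" and f: "\<And>w. w \<noteq> 0 \<Longrightarrow> cmod w < r \<Longrightarrow> (\<lambda>j. w ^ j *\<^sub>C c j) sums f w"
  obtains K where "\<And>w. w \<noteq> 0 \<Longrightarrow> cmod w < r / 4 \<Longrightarrow>
    norm (f w - (\<Sum>j<n. w ^ j *\<^sub>C c j)) \<le> K * cmod w ^ n"
proof -
  define q where "q = r / 2"
  have q: "q > 0" "q < r" using \<open>r > 0\<close> by (auto simp: q_def)
  have "summable (\<lambda>j. complex_of_real q ^ j *\<^sub>C c j)"
    using f[of "complex_of_real q"] q by (auto simp: sums_iff)
  then have "(\<lambda>j. complex_of_real q ^ j *\<^sub>C c j) \<longlonglongrightarrow> 0"
    by (rule summable_LIMSEQ_zero)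
  then have "Bseq (\<lambda>j. complex_of_real q ^ j *\<^sub>C c j)"
    by (intro convergent_imp_Bseq convergentI)
  then obtain M where M: "\<And>j. norm (complex_of_real q ^ j *\<^sub>C c j) \<le> M"
    by (auto simp: Bseq_def)
  have M': "norm (c j) \<le> M / q ^ j" for j
    using M[of j] q by (simp add: norm_scaleC norm_power field_simps)
  have "M \<ge> 0" using M[of 0] norm_ge_zero order_trans by blast
  show thesis
  proof (rule that[of "M / q ^ n * 2"])
    fix w :: complex assume w: "w \<noteq> 0" "cmod w < r / 4"
    let ?t = "\<lambda>i. w ^ (i + n) *\<^sub>C c (i + n)"
    let ?g = "\<lambda>i. cmod w ^ n * (M / q ^ n) * (1/2) ^ i"
    have t: "?t sums (f w - (\<Sum>j<n. w ^ j *\<^sub>C c j))"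
      using sums_split_initial_segment[OF f[of w]] w \<open>r > 0\<close> by simp
    have g: "?g sums (cmod w ^ n * (M / q ^ n) * 2)"
      using sums_mult[OF geometric_sums[of "1/2::real"], of "cmod w ^ n * (M / q ^ n)"] by simp
    have le: "norm (?t i) \<le> ?g i" for i
    proof -
      have "norm (?t i) \<le> cmod w ^ (i + n) * (M / q ^ (i + n))"
        using mult_left_mono[OF M'[of "i + n"], of "cmod w ^ (i + n)"]
        by (simp add: norm_scaleC norm_power)
      also have "\<dots> = cmod w ^ n * (M / q ^ n) * (cmod w / q) ^ i"
        using q by (simp add: power_add field_simps)
      also have "\<dots> \<le> ?g i"
        using w q \<open>M \<ge> 0\<close> by (intro mult_left_mono power_mono) (auto simp: q_def field_simps)
      finally show ?thesis .
    qed
    have "norm (suminf ?t) \<le> suminf ?g"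
      using le g by (intro norm_suminf_le) (auto simp: sums_iff)
    then show "norm (f w - (\<Sum>j<n. w ^ j *\<^sub>C c j)) \<le> M / q ^ n * 2 * cmod w ^ n"
      using t g by (simp add: sums_iff mult_ac)
  qed
qed

lemma polynomial_coeffs_eq_0:
  fixes D :: "nat \<Rightarrow> 'b::complex_normed_vector"
  assumes "s > 0" and bd: "\<And>w. w \<noteq> 0 \<Longrightarrow> cmod w < s \<Longrightarrow> norm (\<Sum>j<n. w ^ j *\<^sub>C D j) \<le> K * cmod w ^ n"
  shows "j < n \<Longrightarrow> D j = 0"
proof (induction j rule: less_induct)
  case (less j)
  define L where "L = \<bar>K\<bar> + (\<Sum>i\<in>{j<..<n}. norm (D i))"
  have "L \<ge> 0" unfolding L_def by (intro add_nonneg_nonneg sum_nonneg) auto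
  have bound: "norm (D j) \<le> L * e" if e: "0 < e" "e < s" "e < 1" for e :: real
  proof -
    define w where "w = complex_of_real e"
    have w: "w \<noteq> 0" "cmod w = e" using e by (auto simp: w_def)
    have "{..<n} = {..<j} \<union> insert j {j<..<n}" using less.prems by auto
    then have "(\<Sum>i<n. w ^ i *\<^sub>C D i) = (\<Sum>i\<in>{..<j} \<union> insert j {j<..<n}. w ^ i *\<^sub>C D i)"
      by simp
    also have "\<dots> = (\<Sum>i<j. w ^ i *\<^sub>C D i) + (\<Sum>i\<in>insert j {j<..<n}. w ^ i *\<^sub>C D i)"
      by (intro sum.union_disjoint) auto
    also have "(\<Sum>i<j. w ^ i *\<^sub>C D i) = 0"
      using less by (intro sum.neutral) auto
    finally have eq: "w ^ j *\<^sub>C D j = (\<Sum>i<n. w ^ i *\<^sub>C D i) - (\<Sum>i\<in>{j<..<n}. w ^ i *\<^sub>C D i)"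
      by simp
    have "norm (\<Sum>i<n. w ^ i *\<^sub>C D i) \<le> K * e ^ n" using bd[of w] w e by simp
    also have "\<dots> \<le> \<bar>K\<bar> * e ^ Suc j"
      using less.prems e by (intro mult_mono power_decreasing) auto
    finally have 1: "norm (\<Sum>i<n. w ^ i *\<^sub>C D i) \<le> \<bar>K\<bar> * e ^ Suc j" .
    have "norm (\<Sum>i\<in>{j<..<n}. w ^ i *\<^sub>C D i) \<le> (\<Sum>i\<in>{j<..<n}. e ^ Suc j * norm (D i))"
      using e w by (intro sum_norm_le)
        (auto simp: norm_scaleC norm_power intro!: mult_right_mono power_decreasing
           simp del: power_Suc)
    then have "norm (w ^ j *\<^sub>C D j) \<le> \<bar>K\<bar> * e ^ Suc j + (\<Sum>i\<in>{j<..<n}. e ^ Suc j * norm (D i))"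
      unfolding eq using 1 norm_triangle_ineq4 by (smt (verit, best))
    then have "e ^ j * norm (D j) \<le> e ^ j * (L * e)"
      using w by (simp add: norm_scaleC norm_power L_def sum_distrib_left[symmetric] algebra_simps)
    then show ?thesis using e by simp
  qed
  show "D j = 0"
  proof (rule ccontr)
    assume nz: "D j \<noteq> 0"
    define e where "e = min (min (s / 2) (1 / 2)) (norm (D j) / (2 * (L + 1)))"
    have e: "0 < e" "e < s" "e < 1" "e \<le> norm (D j) / (2 * (L + 1))"
      using nz \<open>s > 0\<close> \<open>L \<ge> 0\<close> by (auto simp: e_def)
    have "norm (D j) \<le> L * e" by (rule bound) fact+
    also have "\<dots> \<le> (L + 1) * (norm (D j) / (2 * (L + 1)))"
      using e \<open>L \<ge> 0\<close> by (intro mult_mono) auto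
    also have "\<dots> = norm (D j) / 2" using \<open>L \<ge> 0\<close> by (simp add: field_simps)
    finally show False using nz by simp
  qed
qed

lemma product_series_coeffs:
  fixes a b :: "nat \<Rightarrow> 'a::complex_banach \<Rightarrow>\<^sub>L 'a"
  assumes "r > 0" and a: "\<And>i. a i \<in> clinear_ops"
    and f: "\<And>w. w \<noteq> 0 \<Longrightarrow> cmod w < r \<Longrightarrow> (\<lambda>j. w ^ j *\<^sub>C a j) sums f w"
    and g: "\<And>w. w \<noteq> 0 \<Longrightarrow> cmod w < r \<Longrightarrow> (\<lambda>j. w ^ j *\<^sub>C b j) sums g w"
    and fg: "\<And>w. w \<noteq> 0 \<Longrightarrow> cmod w < r \<Longrightarrow> f w o\<^sub>L g w = w ^ m *\<^sub>C D"
  shows "(\<Sum>i\<le>n. a i o\<^sub>L b (n - i)) = (if n = m then D else 0)"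
proof -
  interpret comp: bounded_bilinear "(o\<^sub>L) :: ('a \<Rightarrow>\<^sub>L 'a) \<Rightarrow> ('a \<Rightarrow>\<^sub>L 'a) \<Rightarrow> 'a \<Rightarrow>\<^sub>L 'a"
    by (rule bounded_bilinear_blinfun_compose)
  define M where "M = Suc (max n m)"
  obtain K where K: "\<And>w. w \<noteq> 0 \<Longrightarrow> cmod w < r / 4 \<Longrightarrow>
    norm (f w - (\<Sum>j<M. w ^ j *\<^sub>C a j)) \<le> K * cmod w ^ M"
    using power_series_remainder[OF \<open>r > 0\<close> f, where n = M] by blast
  obtain L where L: "\<And>w. w \<noteq> 0 \<Longrightarrow> cmod w < r / 4 \<Longrightarrow>
    norm (g w - (\<Sum>j<M. w ^ j *\<^sub>C b j)) \<le> L * cmod w ^ M"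
    using power_series_remainder[OF \<open>r > 0\<close> g, where n = M] by blast
  obtain L0 where L0: "\<And>w. w \<noteq> 0 \<Longrightarrow> cmod w < r / 4 \<Longrightarrow> norm (g w) \<le> L0"
    using power_series_remainder[OF \<open>r > 0\<close> g, where n = 0] by auto
  define s where "s = min (r / 4) 1"
  define X where "X = {..<M} \<times> {..<M} - {(i, j). i + j < M}"
  define B where "B = K * L0 + (\<Sum>i<M. norm (a i)) * L + (\<Sum>(i, j)\<in>X. norm (a i o\<^sub>L b j))"
  have [simp]: "finite X" by (simp add: X_def)
  have "s > 0" using \<open>r > 0\<close> by (simp add: s_def)
  have "norm (\<Sum>k<M. w ^ k *\<^sub>C ((\<Sum>i\<le>k. a i o\<^sub>L b (k - i)) - (if k = m then D else 0))) \<le> B * cmod w ^ M"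
    if w: "w \<noteq> 0" "cmod w < s" for w
  proof -
    have w': "cmod w < r / 4" "cmod w < r" "cmod w \<le> 1" using w \<open>r > 0\<close> by (auto simp: s_def)
    define P where "P = (\<Sum>j<M. w ^ j *\<^sub>C a j)"
    define Q where "Q = (\<Sum>j<M. w ^ j *\<^sub>C b j)"
    have sub: "{(i, j). i + j < M} \<subseteq> {..<M} \<times> {..<M}" by auto
    have "P o\<^sub>L Q = (\<Sum>(i, j)\<in>{..<M} \<times> {..<M}. w ^ (i + j) *\<^sub>C (a i o\<^sub>L b j))"
      unfolding P_def comp.sum_left unfolding Q_def comp.sum_right
      by (simp add: sum.cartesian_product blinfun_compose_scaleC_left blinfun_compose_scaleC_right
          a scaleC_scaleC power_add)
    also have "\<dots> = (\<Sum>(i, j)\<in>X. w ^ (i + j) *\<^sub>C (a i o\<^sub>L b j)) +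
        (\<Sum>(i, j)\<in>{(i, j). i + j < M}. w ^ (i + j) *\<^sub>C (a i o\<^sub>L b j))"
      unfolding X_def using sub by (intro sum.subset_diff) auto
    also have "(\<Sum>(i, j)\<in>{(i, j). i + j < M}. w ^ (i + j) *\<^sub>C (a i o\<^sub>L b j)) =
        (\<Sum>k<M. w ^ k *\<^sub>C (\<Sum>i\<le>k. a i o\<^sub>L b (k - i)))"
      by (simp add: sum.triangle_reindex complex_vector.scale_sum_right)
    finally have PQ: "P o\<^sub>L Q = (\<Sum>(i, j)\<in>X. w ^ (i + j) *\<^sub>C (a i o\<^sub>L b j)) +
        (\<Sum>k<M. w ^ k *\<^sub>C (\<Sum>i\<le>k. a i o\<^sub>L b (k - i)))" .
    have "(\<Sum>k<M. w ^ k *\<^sub>C (if k = m then D else 0)) = (\<Sum>k<M. if k = m then w ^ m *\<^sub>C D else 0)"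
      by (intro sum.cong) auto
    also have "\<dots> = f w o\<^sub>L g w"
      using fg[of w] w w' by (simp add: M_def)
    finally have "(\<Sum>k<M. w ^ k *\<^sub>C ((\<Sum>i\<le>k. a i o\<^sub>L b (k - i)) - (if k = m then D else 0))) =
        (P o\<^sub>L Q) - (\<Sum>(i, j)\<in>X. w ^ (i + j) *\<^sub>C (a i o\<^sub>L b j)) - (f w o\<^sub>L g w)"
      by (simp add: PQ complex_vector.scale_right_diff_distrib sum_subtractf)
    also have "\<dots> = - ((f w - P) o\<^sub>L g w) - (P o\<^sub>L (g w - Q)) - (\<Sum>(i, j)\<in>X. w ^ (i + j) *\<^sub>C (a i o\<^sub>L b j))"
      by (simp add: comp.diff_left comp.diff_right)
    finally have eq: "norm (\<Sum>k<M. w ^ k *\<^sub>C ((\<Sum>i\<le>k. a i o\<^sub>L b (k - i)) - (if k = m then D else 0)))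
        \<le> norm ((f w - P) o\<^sub>L g w) + norm (P o\<^sub>L (g w - Q)) + norm (\<Sum>(i, j)\<in>X. w ^ (i + j) *\<^sub>C (a i o\<^sub>L b j))"
      by (smt (verit) norm_minus_cancel norm_triangle_ineq4)
    have "norm ((f w - P) o\<^sub>L g w) \<le> norm (f w - P) * norm (g w)"
      by (rule norm_blinfun_compose)
    also have "\<dots> \<le> (K * cmod w ^ M) * L0"
      using K[of w] L0[of w] w w' norm_ge_zero order_trans unfolding P_def
      by (intro mult_mono) blast+
    finally have 1: "norm ((f w - P) o\<^sub>L g w) \<le> K * L0 * cmod w ^ M" by (simp add: mult_ac)
    have "norm P \<le> (\<Sum>i<M. norm (a i))"
      unfolding P_def using w' by (intro sum_norm_le) (simp add: norm_scaleC norm_power mult_left_le_one_le power_le_one)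
    then have "norm P * norm (g w - Q) \<le> (\<Sum>i<M. norm (a i)) * (L * cmod w ^ M)"
      using L[of w] w w' unfolding Q_def by (intro mult_mono) (auto intro: sum_nonneg)
    then have 2: "norm (P o\<^sub>L (g w - Q)) \<le> (\<Sum>i<M. norm (a i)) * L * cmod w ^ M"
      using norm_blinfun_compose[of P "g w - Q"] by (simp add: mult_ac)
    have "norm (\<Sum>(i, j)\<in>X. w ^ (i + j) *\<^sub>C (a i o\<^sub>L b j)) \<le> (\<Sum>(i, j)\<in>X. cmod w ^ M * norm (a i o\<^sub>L b j))"
      using w' by (intro sum_norm_le)
        (auto simp: norm_scaleC norm_power X_def intro!: mult_right_mono power_decreasing)
    then have 3: "norm (\<Sum>(i, j)\<in>X. w ^ (i + j) *\<^sub>C (a i o\<^sub>L b j)) \<le> (\<Sum>(i, j)\<in>X. norm (a i o\<^sub>L b j)) * cmod w ^ M"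
      by (simp add: sum_distrib_left mult.commute[of _ "cmod w ^ M"] case_prod_unfold)
    show ?thesis
      using eq 1 2 3 by (simp add: B_def distrib_right)
  qed
  from polynomial_coeffs_eq_0[OF \<open>s > 0\<close> this, of n]
  show ?thesis by (simp add: M_def)
qed

lemma sum_int_interval_conv_nat:
  fixes h :: "int \<Rightarrow> 'b::comm_monoid_add"
  shows "(\<Sum>k = - int m..int n - int m. h k) = (\<Sum>i\<le>n. h (int i - int m))"
    and "(\<Sum>k = - int m..int n - int m. h k) = (\<Sum>i\<le>n. h (int (n - i) - int m))"
proof -
  show *: "(\<Sum>k = - int m..int n - int m. h k) = (\<Sum>i\<le>n. h (int i - int m))"
    by (intro sum.reindex_bij_witness[of _ "\<lambda>i. int i - int m" "\<lambda>k. nat (k + int m)"]) auto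
  have "(\<Sum>i\<le>n. h (int i - int m)) = (\<Sum>i\<le>n. h (int (n - i) - int m))"
    by (intro sum.reindex_bij_witness[of _ "\<lambda>i. n - i" "\<lambda>i. n - i"]) auto
  with * show "(\<Sum>k = - int m..int n - int m. h k) = (\<Sum>i\<le>n. h (int (n - i) - int m))"
    by simp
qed

lemma inverse_ops_op_inverse:
  assumes "invertible_op T"
  shows "inverse_ops T (op_inverse T)"
proof -
  obtain S where S: "inverse_ops T S" using assms by (auto simp: invertible_op_def)
  have "S' = S" if "inverse_ops T S'" for S'
  proof -
    have "S' = S' o\<^sub>L (T o\<^sub>L S)" using S by (auto simp: inverse_ops_def intro: blinfun_eqI)
    also have "\<dots> = (S' o\<^sub>L T) o\<^sub>L S" by (simp add: blinfun_eqI)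
    finally show ?thesis using that by (auto simp: inverse_ops_def intro: blinfun_eqI)
  qed
  with S show ?thesis unfolding op_inverse_def by (rule theI)
qed

theorem inverse_laurent_coeffs:
  fixes A :: "complex \<Rightarrow> ('a::complex_banach \<Rightarrow>\<^sub>L 'a)"
  assumes "open U" and pencil: "fredholm_pencil A U"
    and z0: "z\<^sub>0 isolated_in pencil_spectrum A U"
    and taylor: "\<forall>j. a j \<in> clinear_ops" "has_taylor_series A z\<^sub>0 a"
    and laurent: "\<forall>j\<ge>- int m. N j \<in> clinear_ops" "has_laurent_series (\<lambda>z. op_inverse (A z)) z\<^sub>0 m N"
    and n: "n \<ge> - int m"
  shows "(\<Sum>k = - int m..n. N k (a (nat (n - k)) x)) = (if n = 0 then x else 0)"
    and "(\<Sum>k = - int m..n. a (nat (n - k)) (N k x)) = (if n = 0 then x else 0)"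
proof -
  define p where "p = nat (n + int m)"
  have p: "n = int p - int m" using n by (simp add: p_def)
  obtain r1 where r1: "r1 > 0"
    "\<And>z. z \<in> ball z\<^sub>0 r1 \<Longrightarrow> (\<lambda>j. (z - z\<^sub>0) ^ j *\<^sub>C a j) sums A z"
    using taylor(2) unfolding has_taylor_series_def by blast
  obtain r2 where r2: "r2 > 0" "\<And>z. z \<in> ball z\<^sub>0 r2 - {z\<^sub>0} \<Longrightarrow>
    (\<lambda>n. (z - z\<^sub>0) powi (int n - int m) *\<^sub>C N (int n - int m)) sums op_inverse (A z)"
    using laurent(2) unfolding has_laurent_series_def by blast
  obtain r3 where r3: "r3 > 0" "\<And>z. z \<in> pencil_spectrum A U \<Longrightarrow> dist z\<^sub>0 z < r3 \<Longrightarrow> z = z\<^sub>0"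
    using z0 unfolding isolated_in_dist_Ex_iff by blast
  have "z\<^sub>0 \<in> U" using z0 unfolding isolated_in_dist_Ex_iff by (auto simp: pencil_spectrum_def)
  then obtain r4 where r4: "r4 > 0" "ball z\<^sub>0 r4 \<subseteq> U"
    using \<open>open U\<close> open_contains_ball by blast
  define r where "r = Min {r1, r2, r3, r4}"
  have "r > 0" using r1 r2 r3 r4 by (simp add: r_def)
  define f where "f = (\<lambda>w. A (z\<^sub>0 + w))"
  define g where "g = (\<lambda>w. w ^ m *\<^sub>C op_inverse (f w))"
  define b where "b = (\<lambda>i. N (int i - int m))"
  have b: "b i \<in> clinear_ops" for i using laurent(1) by (simp add: b_def)
  have f: "(\<lambda>j. w ^ j *\<^sub>C a j) sums f w" if "cmod w < r" for w
    using r1(2)[of "z\<^sub>0 + w"] that by (simp add: f_def r_def dist_norm)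
  have g: "(\<lambda>j. w ^ j *\<^sub>C b j) sums g w" if w: "w \<noteq> 0" "cmod w < r" for w
  proof -
    have "(\<lambda>n. w powi (int n - int m) *\<^sub>C b n) sums op_inverse (A (z\<^sub>0 + w))"
      using r2(2)[of "z\<^sub>0 + w"] w by (simp add: b_def r_def dist_norm)
    moreover have "bounded_linear (\<lambda>x. w ^ m *\<^sub>C x :: 'a \<Rightarrow>\<^sub>L 'a)"
      by (rule bounded_linear_intro[where K = "cmod (w ^ m)"])
        (simp_all add: scaleC_add_right scaleR_scaleC scaleC_scaleC norm_scaleC mult.commute)
    ultimately have "(\<lambda>n. w ^ m *\<^sub>C w powi (int n - int m) *\<^sub>C b n) sums g w"
      unfolding g_def f_def by (rule bounded_linear.sums[rotated])
    moreover have "w ^ m * w powi (int n - int m) = w ^ n" for n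
      using w by (simp add: power_int_diff)
    ultimately show ?thesis by (simp add: scaleC_scaleC)
  qed
  have inv: "inverse_ops (f w) (op_inverse (f w))" "f w \<in> clinear_ops"
    if w: "w \<noteq> 0" "cmod w < r" for w
  proof -
    have U: "z\<^sub>0 + w \<in> U" using r4 w by (auto simp: r_def dist_norm)
    then have "z\<^sub>0 + w \<notin> pencil_spectrum A U" using r3(2)[of "z\<^sub>0 + w"] w by (auto simp: r_def dist_norm)
    with U show "inverse_ops (f w) (op_inverse (f w))"
      by (intro inverse_ops_op_inverse) (auto simp: pencil_spectrum_def f_def)
    show "f w \<in> clinear_ops"
      using pencil U by (auto simp: fredholm_pencil_def fredholm_op_def f_def)
  qed
  have gf: "g w o\<^sub>L f w = w ^ m *\<^sub>C id_blinfun" "f w o\<^sub>L g w = w ^ m *\<^sub>C id_blinfun"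
    if "w \<noteq> 0" "cmod w < r" for w
    using inv[OF that] by (simp_all add: g_def inverse_ops_def
        blinfun_compose_scaleC_left blinfun_compose_scaleC_right)
  have "(\<Sum>i\<le>p. b i o\<^sub>L a (p - i)) = (if p = m then id_blinfun else 0)"
    using g f gf(1) b by (intro product_series_coeffs[OF \<open>r > 0\<close>]) auto
  from arg_cong[OF this, of "\<lambda>T. blinfun_apply T x"]
  have "(\<Sum>i\<le>p. b i (a (p - i) x)) = (if p = m then x else 0)"
    by (simp add: blinfun.sum_left split: if_splits)
  then show "(\<Sum>k = - int m..n. N k (a (nat (n - k)) x)) = (if n = 0 then x else 0)"
    unfolding p sum_int_interval_conv_nat(1) by (simp add: b_def of_nat_diff nat_diff_distrib)
  have "(\<Sum>i\<le>p. a i o\<^sub>L b (p - i)) = (if p = m then id_blinfun else 0)"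
    using g f gf(2) taylor(1) by (intro product_series_coeffs[OF \<open>r > 0\<close>]) auto
  from arg_cong[OF this, of "\<lambda>T. blinfun_apply T x"]
  have "(\<Sum>i\<le>p. a i (b (p - i) x)) = (if p = m then x else 0)"
    by (simp add: blinfun.sum_left split: if_splits)
  then show "(\<Sum>k = - int m..n. a (nat (n - k)) (N k x)) = (if n = 0 then x else 0)"
    unfolding p sum_int_interval_conv_nat(2) by (simp add: b_def of_nat_diff nat_diff_distrib)
qed

section \<open>Finite-dimensional subspaces and projections\<close>

lemma clinear_ops_linear: "T \<in> clinear_ops \<Longrightarrow> Vector_Spaces.linear scaleC scaleC (blinfun_apply T)"
  by (simp add: clinear_ops_def)

lemma linear_scaleC_iff:
  "Vector_Spaces.linear scaleC scaleC f \<longleftrightarrow>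
    (\<forall>x y. f (x + y) = f x + f y) \<and> (\<forall>c x. f (c *\<^sub>C x) = c *\<^sub>C f x)"
  unfolding Vector_Spaces.linear_def module_hom_def module_hom_axioms_def
  by (auto simp: complex_vector.vector_space_axioms complex_vector.module_axioms)

lemma csubspace_range: "T \<in> clinear_ops \<Longrightarrow> csubspace (range (blinfun_apply T))"
  using clinear_ops_linear[of T]
  by (auto simp: Vector_Spaces.linear_def intro!: module_hom.subspace_image complex_vector.subspace_UNIV)

lemma csubspace_op_kernel: "T \<in> clinear_ops \<Longrightarrow> csubspace (op_kernel T)"
  by (simp add: op_kernel_def complex_vector.subspace_def blinfun.add_right clinear_ops_scaleC)

lemma closed_op_kernel: "closed (op_kernel T)"
proof -
  have "op_kernel T = blinfun_apply T -` {0}" by (auto simp: op_kernel_def)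
  then show ?thesis by (simp add: continuous_on_closed_vimage[THEN iffD1] blinfun.continuous_on closed_vimage)
qed

lemma complement_within_exists:
  fixes V W :: "'a::complex_vector set"
  assumes V: "csubspace V" and W: "csubspace W" and "V \<subseteq> W"
  shows "\<exists>C. csubspace C \<and> C \<subseteq> W \<and> V \<inter> C = {0} \<and> (\<forall>x\<in>W. \<exists>v\<in>V. \<exists>c\<in>C. x = v + c)"
proof -
  interpret vector_space_pair "scaleC :: complex \<Rightarrow> 'a \<Rightarrow> 'a" "scaleC :: complex \<Rightarrow> 'a \<Rightarrow> 'a" ..
  have "Vector_Spaces.linear scaleC scaleC (\<lambda>x::'a. x)" by (simp add: linear_scaleC_iff)
  from linear_exists_left_inverse_on[OF this V]
  obtain g where g: "range g \<subseteq> V" "Vector_Spaces.linear scaleC scaleC g" "\<And>v. v \<in> V \<Longrightarrow> g v = v"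
    by auto
  interpret g: Vector_Spaces.linear scaleC scaleC g by fact
  show ?thesis
  proof (intro exI[of _ "W \<inter> {x. g x = 0}"] conjI ballI)
    show "csubspace (W \<inter> {x. g x = 0})"
      using W g.subspace_kernel by (rule complex_vector.subspace_inter)
    show "V \<inter> (W \<inter> {x. g x = 0}) = {0}"
      using g(3) complex_vector.subspace_0[OF V] complex_vector.subspace_0[OF W] by auto
    fix x assume "x \<in> W"
    have "g x \<in> V" using g(1) by auto
    then have "x - g x \<in> W \<inter> {x. g x = 0}"
      using \<open>x \<in> W\<close> \<open>V \<subseteq> W\<close> g(3) by (auto intro: complex_vector.subspace_diff[OF W] simp: g.diff)
    with \<open>g x \<in> V\<close> show "\<exists>v\<in>V. \<exists>c\<in>W \<inter> {x. g x = 0}. x = v + c"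
      by (intro bexI[of _ "g x"] bexI[of _ "x - g x"]) auto
  qed auto
qed

lemma finite_dim_subset:
  assumes "finite_dim V" "csubspace W" "W \<subseteq> V"
  shows "finite_dim W"
proof -
  obtain F where F: "finite F" "V = cspan F" using assms by (auto simp: finite_dim_def)
  obtain B where B: "B \<subseteq> W" "complex_vector.independent B" "W \<subseteq> cspan B"
    by (rule complex_vector.maximal_independent_subset)
  have "finite B" using complex_vector.independent_span_bound[OF F(1) B(2)] B assms F by auto
  moreover have "W = cspan B" using B assms complex_vector.span_minimal by blast
  ultimately show ?thesis by (auto simp: finite_dim_def)
qed

lemma finite_dim_image:
  assumes f: "Vector_Spaces.linear scaleC scaleC f" and "finite_dim V"
  shows "finite_dim (f ` V)"
proof -
  interpret f: Vector_Spaces.linear scaleC scaleC f by fact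
  obtain F where "finite F" "V = cspan F" using assms by (auto simp: finite_dim_def)
  then show ?thesis by (auto simp: finite_dim_def f.span_image[symmetric])
qed

lemma finite_dim_sum_subspaces:
  assumes "finite_dim V" "finite_dim W"
  shows "\<exists>X. finite_dim X \<and> (\<forall>v\<in>V. \<forall>w\<in>W. v + w \<in> X)"
proof -
  obtain F G where F: "finite F" "V = cspan F" and G: "finite G" "W = cspan G"
    using assms by (auto simp: finite_dim_def)
  show ?thesis
  proof (intro exI conjI ballI)
    show "finite_dim (cspan (F \<union> G))" using F G by (auto simp: finite_dim_def)
    show "v + w \<in> cspan (F \<union> G)" if "v \<in> V" "w \<in> W" for v w
      using that F G by (auto simp: complex_vector.span_Un)
  qed
qed

lemma finite_dim_sum_functions:
  assumes "finite I" "\<And>i. i \<in> I \<Longrightarrow> \<exists>V. finite_dim V \<and> range (f i) \<subseteq> V"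
  shows "\<exists>V. finite_dim V \<and> range (\<lambda>x. \<Sum>i\<in>I. f i x) \<subseteq> V"
  using assms
proof (induction I rule: finite_induct)
  case empty
  show ?case by (rule exI[of _ "cspan {}"]) (auto simp: finite_dim_def)
next
  case (insert i I)
  obtain V where V: "finite_dim V" "range (f i) \<subseteq> V" using insert by blast
  obtain W where W: "finite_dim W" "range (\<lambda>x. \<Sum>i\<in>I. f i x) \<subseteq> W" using insert by blast
  obtain X where "finite_dim X" "\<forall>v\<in>V. \<forall>w\<in>W. v + w \<in> X"
    using finite_dim_sum_subspaces[OF V(1) W(1)] by blast
  with V W insert.hyps show ?case by (intro exI[of _ X]) (auto simp: image_subset_iff)
qed

lemma finite_lift_through_linear:
  assumes f: "Vector_Spaces.linear scaleC scaleC f"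
    and "finite_dim V" "csubspace W" "f ` W \<subseteq> V"
  shows "\<exists>G. finite G \<and> G \<subseteq> W \<and> (\<forall>x\<in>W. \<exists>u\<in>cspan G. f x = f u)"
proof -
  interpret f: Vector_Spaces.linear scaleC scaleC f by fact
  have "finite_dim (f ` W)"
    using assms(2) f.subspace_image[OF assms(3)] assms(4) by (rule finite_dim_subset)
  then obtain H where H: "finite H" "f ` W = cspan H" by (auto simp: finite_dim_def)
  then have "H \<subseteq> f ` W" using complex_vector.span_superset by blast
  then obtain G where G: "G \<subseteq> W" "finite G" "H = f ` G" using H(1) finite_subset_image by metis
  with H have "f ` W = f ` cspan G" by (simp add: f.span_image)
  then have "\<exists>u\<in>cspan G. f x = f u" if "x \<in> W" for x
    using that imageI[of x W f] by auto
  with G show ?thesis by blast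
qed

lemma finite_dim_vimage:
  assumes T: "T \<in> clinear_ops" and "finite_dim (op_kernel T)" "finite_dim V"
  shows "finite_dim (blinfun_apply T -` V)"
proof -
  interpret T: Vector_Spaces.linear scaleC scaleC "blinfun_apply T" using T by (rule clinear_ops_linear)
  have "csubspace V" using assms(3) by (auto simp: finite_dim_def complex_vector.subspace_span)
  then have sub: "csubspace (blinfun_apply T -` V)" by (rule T.subspace_vimage)
  obtain G where G: "finite G" "\<forall>x\<in>blinfun_apply T -` V. \<exists>u\<in>cspan G. T x = T u"
    using finite_lift_through_linear[OF clinear_ops_linear[OF T] assms(3) sub image_vimage_subset] by blast
  have "finite_dim (cspan G)" using G(1) by (auto simp: finite_dim_def)
  obtain X where X: "finite_dim X" "\<forall>v\<in>op_kernel T. \<forall>w\<in>cspan G. v + w \<in> X"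
    using finite_dim_sum_subspaces[OF assms(2) \<open>finite_dim (cspan G)\<close>] by blast
  have "x \<in> X" if "x \<in> blinfun_apply T -` V" for x
  proof -
    obtain u where u: "u \<in> cspan G" "T x = T u" using G(2) \<open>x \<in> _\<close> by blast
    then have "x - u \<in> op_kernel T" by (simp add: op_kernel_def blinfun.diff_right)
    then show ?thesis using X(2) u(1) by (metis diff_add_cancel)
  qed
  with X(1) sub show ?thesis by (auto intro: finite_dim_subset)
qed

lemma closed_add_line:
  fixes W :: "'a::complex_normed_vector set"
  assumes W: "csubspace W" "closed W"
  shows "closed {w + c *\<^sub>C b | w c. w \<in> W}"
proof (cases "b \<in> W")
  case True
  then have "{w + c *\<^sub>C b | w c. w \<in> W} = W"
    using W(1) by (auto simp: complex_vector.subspace_add complex_vector.subspace_scale)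
      (metis add.right_neutral complex_vector.scale_zero_left)
  with W show ?thesis by simp
next
  case False
  define d where "d = infdist b W"
  have "W \<noteq> {}" using complex_vector.subspace_0[OF W(1)] by auto
  have "d > 0" unfolding d_def using W \<open>W \<noteq> {}\<close> False by (intro infdist_pos_not_in_closed)
  have le: "cmod c * d \<le> norm (w + c *\<^sub>C b)" if w: "w \<in> W" for w c
  proof (cases "c = 0")
    case nz: False
    have "d \<le> norm (b - (- inverse c) *\<^sub>C w)"
      using infdist_le[of "(- inverse c) *\<^sub>C w" W b] W(1) w
      by (simp add: d_def dist_norm complex_vector.subspace_scale complex_vector.subspace_neg)
    then have "cmod c * d \<le> norm (c *\<^sub>C (b - (- inverse c) *\<^sub>C w))"
      by (simp add: norm_scaleC mult_left_mono)
    also have "c *\<^sub>C (b - (- inverse c) *\<^sub>C w) = w + c *\<^sub>C b"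
      using nz by (simp add: scaleC_add_right scaleC_scaleC scaleC_one add.commute)
    finally show ?thesis .
  qed simp
  show ?thesis
    unfolding closed_sequential_limits
  proof (intro allI impI, elim conjE)
    fix x l assume "\<forall>n. x n \<in> {w + c *\<^sub>C b | w c. w \<in> W}" and l: "x \<longlonglongrightarrow> l"
    then have "\<forall>n. \<exists>w c. x n = w + c *\<^sub>C b \<and> w \<in> W" by blast
    then obtain w c where wc: "\<And>n. x n = w n + c n *\<^sub>C b" "\<And>n. w n \<in> W" by metis
    have "Cauchy c"
    proof (rule metric_CauchyI)
      fix e :: real assume "e > 0"
      then have "e * d > 0" using \<open>d > 0\<close> by simp
      with LIMSEQ_imp_Cauchy[OF l] obtain M where M: "\<And>m n. m \<ge> M \<Longrightarrow> n \<ge> M \<Longrightarrow> dist (x m) (x n) < e * d"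
        unfolding Cauchy_def by blast
      show "\<exists>M. \<forall>m\<ge>M. \<forall>n\<ge>M. dist (c m) (c n) < e"
      proof (intro exI[of _ M] allI impI)
        fix m n assume mn: "m \<ge> M" "n \<ge> M"
        have "w m - w n \<in> W" using wc(2) W(1) by (simp add: complex_vector.subspace_diff)
        then have "cmod (c m - c n) * d \<le> norm ((w m - w n) + (c m - c n) *\<^sub>C b)" by (rule le)
        also have "\<dots> = dist (x m) (x n)"
          by (simp add: wc(1) dist_norm complex_vector.scale_left_diff_distrib algebra_simps)
        also have "\<dots> < e * d" using M mn by simp
        finally show "dist (c m) (c n) < e" using \<open>d > 0\<close> by (simp add: dist_norm)
      qed
    qed
    then obtain c0 where c0: "c \<longlonglongrightarrow> c0" using Cauchy_convergent convergent_def by blast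
    have "bounded_linear (\<lambda>c. c *\<^sub>C b)"
      by (rule bounded_linear_intro[where K = "norm b"])
        (simp_all add: scaleC_add_left scaleR_scaleC scaleC_scaleC norm_scaleC scaleR_conv_of_real)
    from bounded_linear.tendsto[OF this c0]
    have "(\<lambda>n. x n - c n *\<^sub>C b) \<longlonglongrightarrow> l - c0 *\<^sub>C b" using l by (intro tendsto_diff)
    moreover have "(\<lambda>n. x n - c n *\<^sub>C b) = w" by (simp add: wc(1))
    ultimately have "l - c0 *\<^sub>C b \<in> W" using W(2) wc(2) closed_sequentially by metis
    then show "l \<in> {w + c *\<^sub>C b | w c. w \<in> W}" by (intro CollectI exI[of _ "l - c0 *\<^sub>C b"] exI[of _ c0]) auto
  qed
qed

lemma closed_add_span:
  fixes W :: "'a::complex_normed_vector set"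
  assumes "finite F" and W: "csubspace W" "closed W"
  shows "closed {w + u | w u. w \<in> W \<and> u \<in> cspan F}"
  using assms(1)
proof (induction F rule: finite_induct)
  case empty
  then show ?case using W by simp
next
  case (insert b F)
  let ?V = "{w + u | w u. w \<in> W \<and> u \<in> cspan F}"
  have "csubspace ?V" using W(1) by (intro complex_vector.subspace_sums complex_vector.subspace_span)
  then have "closed {v + c *\<^sub>C b | v c. v \<in> ?V}" using insert.IH by (rule closed_add_line)
  also have "{v + c *\<^sub>C b | v c. v \<in> ?V} = {w + u | w u. w \<in> W \<and> u \<in> cspan (insert b F)}"
  proof (intro equalityI subsetI)
    fix x assume "x \<in> {v + c *\<^sub>C b | v c. v \<in> ?V}"
    then obtain w u c where *: "x = w + u + c *\<^sub>C b" "w \<in> W" "u \<in> cspan F" by blast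
    then have "u + c *\<^sub>C b \<in> cspan (insert b F)"
      by (auto simp: complex_vector.span_breakdown_eq intro!: exI[of _ c])
    with * show "x \<in> {w + u | w u. w \<in> W \<and> u \<in> cspan (insert b F)}"
      by (auto simp: add.assoc)
  next
    fix x assume "x \<in> {w + u | w u. w \<in> W \<and> u \<in> cspan (insert b F)}"
    then obtain w u c where "x = w + u" "w \<in> W" "u - c *\<^sub>C b \<in> cspan F"
      by (auto simp: complex_vector.span_breakdown_eq)
    then show "x \<in> {v + c *\<^sub>C b | v c. v \<in> ?V}"
      by (intro CollectI exI[of _ "w + (u - c *\<^sub>C b)"] exI[of _ c]) auto
  qed
  finally show ?case .
qed

lemma closed_finite_dim:
  fixes V :: "'a::complex_normed_vector set"
  assumes "finite_dim V" shows "closed V"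
proof -
  obtain F where F: "finite F" "V = cspan F" using assms by (auto simp: finite_dim_def)
  then show ?thesis using closed_add_span[OF F(1), of "{0}"] by simp
qed

lemma closed_if_contains_finite_rank_kernel:
  assumes T: "T \<in> clinear_ops" and "finite_dim V" "range (blinfun_apply T) \<subseteq> V"
    and W: "csubspace W" "op_kernel T \<subseteq> W"
  shows "closed W"
proof -
  have "blinfun_apply T ` W \<subseteq> V" using assms(3) by auto
  obtain G where G: "finite G" "G \<subseteq> W" "\<forall>x\<in>W. \<exists>u\<in>cspan G. T x = T u"
    using finite_lift_through_linear[OF clinear_ops_linear[OF T] assms(2) W(1) \<open>_ ` W \<subseteq> V\<close>] by blast
  have "W = {w + u | w u. w \<in> op_kernel T \<and> u \<in> cspan G}"
  proof (intro equalityI subsetI)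
    fix x assume "x \<in> W"
    then obtain u where u: "u \<in> cspan G" "T x = T u" using G by blast
    then have "x - u \<in> op_kernel T" by (simp add: op_kernel_def blinfun.diff_right)
    with u show "x \<in> {w + u | w u. w \<in> op_kernel T \<and> u \<in> cspan G}"
      by (intro CollectI exI[of _ "x - u"] exI[of _ u]) auto
  next
    fix x assume "x \<in> {w + u | w u. w \<in> op_kernel T \<and> u \<in> cspan G}"
    then show "x \<in> W"
      using W G(2) complex_vector.span_minimal[OF G(2) W(1)] by (auto intro: complex_vector.subspace_add)
  qed
  then show ?thesis
    using closed_add_span[OF G(1) csubspace_op_kernel[OF T] closed_op_kernel] by simp
qed

locale algebraic_sum =
  fixes V W :: "'a::complex_normed_vector set"
  assumes V: "csubspace V" and W: "csubspace W" and Int: "V \<inter> W = {0}"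
    and decomp: "\<exists>v\<in>V. \<exists>w\<in>W. x = v + w"
begin

lemma proj_eqI:
  assumes w: "w \<in> W" "x - w \<in> V"
  shows "proj_along V W x = w"
  unfolding proj_along_def
proof (rule the_equality)
  fix w' assume w': "w' \<in> W \<and> x - w' \<in> V"
  then have "w' - w \<in> W" using w W by (simp add: complex_vector.subspace_diff)
  moreover have "(x - w) - (x - w') \<in> V" by (rule complex_vector.subspace_diff[OF V]) (use w w' in auto)
  ultimately have "w' - w \<in> V \<inter> W" by simp
  with Int show "w' = w" by simp
qed (use w in simp)

lemma proj: "proj_along V W x \<in> W" "x - proj_along V W x \<in> V"
proof -
  obtain v w where "v \<in> V" "w \<in> W" "x = v + w" using decomp by blast
  moreover from this have "proj_along V W x = w" by (intro proj_eqI) auto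
  ultimately show "proj_along V W x \<in> W" "x - proj_along V W x \<in> V" by auto
qed

lemma proj_eq_0_iff: "proj_along V W x = 0 \<longleftrightarrow> x \<in> V"
  using proj(2)[of x] proj_eqI[of 0 x] complex_vector.subspace_0[OF W] by auto

lemma proj_linear: "Vector_Spaces.linear scaleC scaleC (proj_along V W)"
  unfolding linear_scaleC_iff
proof (intro conjI allI proj_eqI)
  fix x y and c :: complex
  show "proj_along V W x + proj_along V W y \<in> W" "c *\<^sub>C proj_along V W x \<in> W"
    using W proj(1) by (auto simp: complex_vector.subspace_add complex_vector.subspace_scale)
  have "(x - proj_along V W x) + (y - proj_along V W y) \<in> V" "c *\<^sub>C (x - proj_along V W x) \<in> V"
    using V proj(2) by (auto simp: complex_vector.subspace_add complex_vector.subspace_scale)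
  then show "x + y - (proj_along V W x + proj_along V W y) \<in> V" "c *\<^sub>C x - c *\<^sub>C proj_along V W x \<in> V"
    by (simp_all add: algebra_simps complex_vector.scale_right_diff_distrib)
qed

lemma finite_dim_if_finite_codim:
  assumes "finite_codim V"
  shows "finite_dim W"
proof -
  obtain F where F: "finite F" "\<And>x. \<exists>u\<in>cspan F. x - u \<in> V"
    using assms by (auto simp: finite_codim_def)
  have "W \<subseteq> proj_along V W ` cspan F"
  proof
    fix w assume w: "w \<in> W"
    obtain u where u: "u \<in> cspan F" "w - u \<in> V" using F by blast
    then have "u - w \<in> V" using complex_vector.subspace_neg[OF V, of "w - u"] by simp
    with w have "proj_along V W u = w" by (rule proj_eqI)
    with u show "w \<in> proj_along V W ` cspan F" by blast
  qed
  moreover have "finite_dim (proj_along V W ` cspan F)"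
    using F(1) by (intro finite_dim_image[OF proj_linear]) (auto simp: finite_dim_def)
  ultimately show ?thesis using W finite_dim_subset by blast
qed

end

lemma complementary_iff: "complementary V W \<longleftrightarrow> algebraic_sum V W \<and> closed V \<and> closed W"
proof -
  have "(\<exists>v w. x = v + w \<and> v \<in> V \<and> w \<in> W) \<longleftrightarrow> (\<exists>v\<in>V. \<exists>w\<in>W. x = v + w)" for x
    by blast
  then have "{v + w | v w. v \<in> V \<and> w \<in> W} = UNIV \<longleftrightarrow> (\<forall>x. \<exists>v\<in>V. \<exists>w\<in>W. x = v + w)"
    by (simp add: set_eq_iff)
  then show ?thesis unfolding direct_sum_def algebraic_sum_def by argo
qed

section \<open>Generalized inverses\<close>

lemma csubspace_R0: "a 0 \<in> clinear_ops \<Longrightarrow> csubspace (R0 a)"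
  by (simp add: R0_def csubspace_range)

lemma csubspace_K0: "a 0 \<in> clinear_ops \<Longrightarrow> csubspace (K0 a)"
  by (simp add: K0_def csubspace_op_kernel)

lemma K0_iff: "x \<in> K0 a \<longleftrightarrow> a 0 x = 0"
  by (simp add: K0_def op_kernel_def)

lemma csubspace_K1:
  assumes "a 0 \<in> clinear_ops" "a 1 \<in> clinear_ops" shows "csubspace (K1 a)"
  using csubspace_K0[of a] csubspace_R0[of a] clinear_ops_scaleC[OF assms(2)] assms(1)
  by (auto simp: K1_def complex_vector.subspace_def blinfun.add_right)

lemma csubspace_R1:
  assumes "a 0 \<in> clinear_ops" "a 1 \<in> clinear_ops" shows "csubspace (R1 a)"
proof -
  interpret Vector_Spaces.linear scaleC scaleC "blinfun_apply (a 1)"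
    using assms(2) by (rule clinear_ops_linear)
  show ?thesis
    unfolding R1_def
    by (intro complex_vector.subspace_sums csubspace_R0 subspace_image csubspace_K0 assms)
qed

lemma R1_memI: "x \<in> K0 a \<Longrightarrow> a 0 u + a 1 x \<in> R1 a"
  by (auto simp: R1_def R0_def)

lemma R0_subset_R1: "R0 a \<subseteq> R1 a"
  using R1_memI[of 0 a] by (auto simp: R0_def K0_iff)

locale complements =
  fixes a :: "nat \<Rightarrow> 'a::complex_normed_vector \<Rightarrow>\<^sub>L 'a" and R0c K0c :: "'a set"
  assumes a_clin: "a j \<in> clinear_ops"
    and R0c: "algebraic_sum (R0 a) R0c" and K0c: "algebraic_sum (K0 a) K0c"
begin

sublocale R0c: algebraic_sum "R0 a" R0c by (rule R0c)

sublocale K0c: algebraic_sum "K0 a" K0c by (rule K0c)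

abbreviation "P \<equiv> proj_along (R0 a) R0c"

abbreviation "g \<equiv> A0_ginv a R0c K0c"

lemma P_add: "P (x + y) = P x + P y" and P_scaleC: "P (c *\<^sub>C x) = c *\<^sub>C P x"
  using R0c.proj_linear by (auto simp: linear_scaleC_iff)

lemma P_diff: "P (x - y) = P x - P y"
  using P_add[of "x - y" y] by simp

lemma a0_inj:
  assumes "x \<in> K0c" "y \<in> K0c" "a 0 x = a 0 y"
  shows "x = y"
proof -
  have "x - y \<in> K0 a \<inter> K0c"
    using assms complex_vector.subspace_diff[OF K0c.W, of x y] by (simp add: K0_iff blinfun.diff_right)
  then show ?thesis by (simp add: K0c.Int)
qed

lemma ginv: "g y \<in> K0c" "a 0 (g y) = y - P y"
proof -
  have inj: "inj_on (a 0) K0c" using a0_inj by (auto simp: inj_on_def)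
  obtain x where x: "y - P y = a 0 x" using R0c.proj(2)[of y] by (auto simp: R0_def)
  obtain k c where "k \<in> K0 a" "c \<in> K0c" "x = k + c" using K0c.decomp by blast
  with x have *: "y - P y \<in> a 0 ` K0c" by (auto simp: K0_iff blinfun.add_right)
  show "g y \<in> K0c" "a 0 (g y) = y - P y"
    unfolding A0_ginv_def using the_inv_into_into[OF inj *, of K0c] f_the_inv_into_f[OF inj *] by auto
qed

lemma a0_ginv_range: "y \<in> R0 a \<Longrightarrow> a 0 (g y) = y"
  by (simp add: ginv R0c.proj_eq_0_iff[THEN iffD2])

lemma ginv_linear: "Vector_Spaces.linear scaleC scaleC g"
  unfolding linear_scaleC_iff
proof (intro conjI allI)
  fix x y and c :: complex
  have "g x + g y \<in> K0c" "c *\<^sub>C g x \<in> K0c"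
    using ginv(1) K0c.W by (auto simp: complex_vector.subspace_add complex_vector.subspace_scale)
  moreover have "a 0 (g (x + y)) = a 0 (g x + g y)" "a 0 (g (c *\<^sub>C x)) = a 0 (c *\<^sub>C g x)"
    by (simp_all add: ginv blinfun.add_right clinear_ops_scaleC[OF a_clin] P_add P_scaleC
        complex_vector.scale_right_diff_distrib)
  ultimately show "g (x + y) = g x + g y" "g (c *\<^sub>C x) = c *\<^sub>C g x"
    using ginv(1) a0_inj by blast+
qed

lemma ginv_add: "g (x + y) = g x + g y" and ginv_scaleC: "g (c *\<^sub>C x) = c *\<^sub>C g x"
  using ginv_linear by (auto simp: linear_scaleC_iff)

lemma ginv_diff: "g (x - y) = g x - g y"
  using ginv_add[of "x - y" y] by simp

lemma A2_dagger_linear: "Vector_Spaces.linear scaleC scaleC (A2_dagger a R0c K0c)"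
  by (simp add: linear_scaleC_iff A2_dagger_def blinfun.add_right ginv_add ginv_scaleC
      clinear_ops_scaleC[OF a_clin] complex_vector.scale_right_diff_distrib)

lemma a0_ginv_a1: "x \<in> K1 a \<Longrightarrow> a 0 (g (a 1 x)) = a 1 x"
  by (simp add: K1_def a0_ginv_range)

end

section \<open>The recursion for the coefficients of the inverse\<close>

locale inverse_coeffs =
  fixes a :: "nat \<Rightarrow> 'a::complex_banach \<Rightarrow>\<^sub>L 'a" and N :: "int \<Rightarrow> 'a \<Rightarrow>\<^sub>L 'a" and m :: nat
  assumes a_clin: "a j \<in> clinear_ops"
    and N_clin: "k \<ge> - int m \<Longrightarrow> N k \<in> clinear_ops"
    and left: "n \<ge> - int m \<Longrightarrow>
      (\<Sum>k = - int m..n. N k (a (nat (n - k)) x)) = (if n = 0 then x else 0)"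
    and right: "n \<ge> - int m \<Longrightarrow>
      (\<Sum>k = - int m..n. a (nat (n - k)) (N k x)) = (if n = 0 then x else 0)"
begin

abbreviation G :: "int \<Rightarrow> nat \<Rightarrow> 'a \<Rightarrow> 'a"
  where "G j l x \<equiv> G_sum a N j l m x"

lemma left_split:
  assumes "j \<ge> - int m"
  shows "G j l x + (\<Sum>i\<le>l. N (j + int i) (a (l - i) x)) = (if j + int l = 0 then x else 0)"
proof -
  let ?f = "\<lambda>k. N k (a (nat (j + int l - k)) x)"
  have idx: "l - nat (k - j) = nat (j + int l - k)" if "j \<le> k" for k
    using that by linarith
  have "{- int m..j + int l} = {- int m..j - 1} \<union> {j..j + int l}" using assms by auto
  then have "sum ?f {- int m..j + int l} = sum ?f {- int m..j - 1} + sum ?f {j..j + int l}"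
    by (simp add: sum.union_disjoint)
  also have "sum ?f {j..j + int l} = (\<Sum>i\<le>l. N (j + int i) (a (l - i) x))"
    by (intro sum.reindex_bij_witness[of _ "\<lambda>i. j + int i" "\<lambda>k. nat (k - j)"])
      (auto simp: idx)
  finally show ?thesis using left[of "j + int l" x] assms by (simp add: G_sum_def)
qed

lemma left_0: "j \<ge> - int m \<Longrightarrow> N j (a 0 x) = (if j = 0 then x else 0) - G j 0 x"
  using left_split[of j 0 x] by (auto simp: eq_diff_eq add.commute)

lemma left_1:
  "j \<ge> - int m \<Longrightarrow> N j (a 1 x) = (if j = - 1 then x else 0) - N (j + 1) (a 0 x) - G j 1 x"
  using left_split[of j 1 x] by (auto simp: eq_diff_eq algebra_simps)

lemma left_2:
  "j \<ge> - int m \<Longrightarrow>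
    N j (a 2 x) = (if j = - 2 then x else 0) - N (j + 1) (a 1 x) - N (j + 2) (a 0 x) - G j 2 x"
  using left_split[of j 2 x] by (auto simp: numeral_2_eq_2 eq_diff_eq algebra_simps)

lemma right_0: "m \<ge> 1 \<Longrightarrow> a 0 (N (- int m) x) = 0"
  using right[of "- int m" x] by simp

lemma right_1: "m \<ge> 2 \<Longrightarrow> a 0 (N (1 - int m) x) + a 1 (N (- int m) x) = 0"
proof -
  assume "m \<ge> 2"
  moreover have "{- int m..1 - int m} = {- int m, 1 - int m}" by auto
  ultimately show ?thesis using right[of "1 - int m" x] by (simp add: add.commute)
qed

lemma right_2:
  "a 0 (N (2 - int m) x) + a 1 (N (1 - int m) x) + a 2 (N (- int m) x) = (if m = 2 then x else 0)"
proof -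
  have "{- int m..2 - int m} = {- int m, 1 - int m, 2 - int m}" by auto
  then show ?thesis using right[of "2 - int m" x] by (simp add: algebra_simps split: if_splits)
qed

lemma G_first: "G (- int m) l x = 0"
  by (simp add: G_sum_def)

lemma G_second: "G (1 - int m) l x = N (- int m) (a (l + 1) x)"
  by (simp add: G_sum_def nat_add_distrib)

lemma leading_coeff_R0: "m \<ge> 1 \<Longrightarrow> N (- int m) (a 0 x) = 0"
  by (simp add: left_0 G_first)

lemma leading_coeff_R1:
  assumes "m \<ge> 2" "y \<in> R1 a"
  shows "N (- int m) y = 0"
proof -
  obtain u h where y: "y = a 0 u + a 1 h" "a 0 h = 0" using assms(2) by (auto simp: R1_def R0_def K0_iff)
  have "N (- int m) (a 1 h) = 0"
    using assms(1) y(2) left_1[of "- int m" h] by (simp add: G_first)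
  with y assms(1) show ?thesis by (simp add: blinfun.add_right leading_coeff_R0)
qed

lemma pole_order_ge_2:
  assumes "m \<ge> 1" and K1: "K1 a \<noteq> {0}"
  shows "m \<ge> 2"
proof (rule ccontr)
  assume "\<not> m \<ge> 2"
  with \<open>m \<ge> 1\<close> have m: "m = 1" by simp
  have "0 \<in> K1 a" using csubspace_K1[OF a_clin a_clin] by (rule complex_vector.subspace_0)
  with K1 obtain x where x: "x \<in> K1 a" "x \<noteq> 0" by auto
  then obtain w where w: "a 1 x = a 0 w" "a 0 x = 0" by (auto simp: K1_def R0_def K0_iff)
  have "N (- 1) (a 1 x) = x" using left_1[of "- 1" x] G_first[of 1 x] w m by simp
  moreover have "N (- 1) (a 1 x) = 0" using leading_coeff_R0[of w] m w by simp
  ultimately show False using x by simp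
qed

end

locale inverse_coeffs_complements = inverse_coeffs + complements
begin

abbreviation "A2d \<equiv> A2_dagger a R0c K0c"

lemma leading_coeff_A2_dagger:
  assumes "m \<ge> 2" "x \<in> K1 a"
  shows "N (- int m) (A2d x) = (if m = 2 then x else 0)"
proof -
  have x: "a 0 x = 0" using assms(2) by (simp add: K1_def K0_iff)
  let ?w = "g (a 1 x)"
  have "N (1 - int m) (a 1 x) = N (1 - int m) (a 0 ?w)"
    by (simp only: a0_ginv_a1[OF assms(2)])
  also have "\<dots> = - N (- int m) (a 1 ?w)"
    using assms(1) by (simp add: left_0 G_second)
  finally show ?thesis
    using assms(1) x left_2[of "- int m" x] by (simp add: A2_dagger_def G_first blinfun.diff_right add.commute)
qed

lemma pole_order_eq_2_if_spanning:
  assumes "m \<ge> 2" "N (- int m) \<noteq> 0" and span: "\<And>y. \<exists>x\<in>K1 a. y - A2d x \<in> R1 a"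
  shows "m = 2"
proof (rule ccontr)
  assume "m \<noteq> 2"
  have "N (- int m) y = 0" for y
  proof -
    obtain x where x: "x \<in> K1 a" "y - A2d x \<in> R1 a" using span by blast
    have "N (- int m) y = N (- int m) (y - A2d x) + N (- int m) (A2d x)"
      by (simp add: blinfun.diff_right)
    then show ?thesis
      using leading_coeff_R1[OF _ x(2)] leading_coeff_A2_dagger[OF _ x(1)] \<open>m \<ge> 2\<close> \<open>m \<noteq> 2\<close> by simp
  qed
  then have "N (- int m) = 0" by (intro blinfun_eqI) simp
  with assms(2) show False by simp
qed

lemma pole_order_eq_2_if_bij:
  assumes "m \<ge> 2" "N (- int m) \<noteq> 0" and R1c: "algebraic_sum (R1 a) R1c"
    and bij: "bij_betw (S_dagger a R0c K0c R1c) (K1 a) R1c"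
  shows "m = 2"
proof (rule pole_order_eq_2_if_spanning[OF assms(1,2)])
  fix y
  interpret R1c: algebraic_sum "R1 a" R1c by fact
  have "proj_along (R1 a) R1c y \<in> S_dagger a R0c K0c R1c ` K1 a"
    using bij R1c.proj(1)[of y] by (simp add: bij_betw_def)
  then obtain x where x: "x \<in> K1 a" "proj_along (R1 a) R1c y = proj_along (R1 a) R1c (A2d x)"
    by (auto simp: S_dagger_def)
  have "(y - proj_along (R1 a) R1c y) - (A2d x - proj_along (R1 a) R1c (A2d x)) \<in> R1 a"
    by (intro complex_vector.subspace_diff[OF R1c.V] R1c.proj)
  with x show "\<exists>x\<in>K1 a. y - A2d x \<in> R1 a" by auto
qed

end

locale double_pole_complements = inverse_coeffs_complements a N 2 R0c K0c for a N R0c K0c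
begin

abbreviation "A3d \<equiv> A3_dagger a R0c K0c"

lemma leading_coeff_K1: "N (- 2) y \<in> K1 a"
proof -
  have "a 1 (N (- 2) y) = a 0 (- N (- 1) y)"
    using right_1[of y] by (simp add: blinfun.minus_right add_eq_0_iff)
  then show ?thesis using right_0[of y] by (simp add: K1_def K0_iff R0_def)
qed

lemma residual_in_R1: "y - A2d (N (- 2) y) \<in> R1 a"
proof -
  let ?x = "N (- 2) y"
  define h where "h = N (- 1) y + g (a 1 ?x)"
  have "a 0 h = 0"
    using right_1[of y] a0_ginv_a1[OF leading_coeff_K1[of y]] by (simp add: h_def blinfun.add_right)
  then have "a 0 (N 0 y) + a 1 h \<in> R1 a" by (intro R1_memI) (simp add: K0_iff)
  also have "a 0 (N 0 y) + a 1 h = y - A2d ?x"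
    using right_2[of y] by (simp add: h_def A2_dagger_def blinfun.add_right algebra_simps)
  finally show ?thesis .
qed

lemma leading_coeff_inverts: "x \<in> K1 a \<Longrightarrow> N (- 2) (A2d x) = x"
  using leading_coeff_A2_dagger[of x] by simp

lemma leading_coeff_vanishes: "y \<in> R1 a \<Longrightarrow> N (- 2) y = 0"
  using leading_coeff_R1[of y] by simp

lemma S_dagger_bij:
  assumes "algebraic_sum (R1 a) R1c"
  shows "bij_betw (S_dagger a R0c K0c R1c) (K1 a) R1c"
    and "N (- 2) y = the_inv_into (K1 a) (S_dagger a R0c K0c R1c) (proj_along (R1 a) R1c y)"
proof -
  interpret R1c: algebraic_sum "R1 a" R1c by fact
  have inv: "N (- 2) (S_dagger a R0c K0c R1c x) = x" if "x \<in> K1 a" for x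
  proof -
    have "N (- 2) (A2d x - S_dagger a R0c K0c R1c x) = 0"
      unfolding S_dagger_def by (intro leading_coeff_vanishes R1c.proj)
    with that show ?thesis by (simp add: blinfun.diff_right leading_coeff_inverts)
  qed
  have S: "S_dagger a R0c K0c R1c (N (- 2) y) = proj_along (R1 a) R1c y" for y
  proof -
    have "(y - A2d (N (- 2) y)) + (A2d (N (- 2) y) - S_dagger a R0c K0c R1c (N (- 2) y)) \<in> R1 a"
      unfolding S_dagger_def by (intro complex_vector.subspace_add[OF R1c.V] residual_in_R1 R1c.proj)
    then show ?thesis
      by (intro R1c.proj_eqI[symmetric]) (simp_all add: S_dagger_def R1c.proj)
  qed
  have "proj_along (R1 a) R1c y = y" if "y \<in> R1c" for y
    using that complex_vector.subspace_0[OF R1c.V] by (intro R1c.proj_eqI) auto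
  then show bij: "bij_betw (S_dagger a R0c K0c R1c) (K1 a) R1c"
    using inv S leading_coeff_K1
    by (intro bij_betw_byWitness[where f' = "N (- 2)"]) (auto simp: S_dagger_def R1c.proj)
  show "N (- 2) y = the_inv_into (K1 a) (S_dagger a R0c K0c R1c) (proj_along (R1 a) R1c y)"
    using bij leading_coeff_K1[of y]
    by (simp add: S[symmetric] bij_betw_def the_inv_into_f_f)
qed

lemma R1_A2_dagger_K1_sum: "algebraic_sum (R1 a) (A2d ` K1 a)"
proof
  interpret A2d: Vector_Spaces.linear scaleC scaleC A2d by (rule A2_dagger_linear)
  show R1: "csubspace (R1 a)" by (intro csubspace_R1 a_clin)
  show im: "csubspace (A2d ` K1 a)" by (intro A2d.subspace_image csubspace_K1 a_clin)
  have "A2d x = 0" if "x \<in> K1 a" "A2d x \<in> R1 a" for x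
    using leading_coeff_vanishes[OF that(2)] leading_coeff_inverts[OF that(1)] A2d.zero by simp
  then show "R1 a \<inter> A2d ` K1 a = {0}"
    using R1 im complex_vector.subspace_0 by auto
  fix y
  show "\<exists>v\<in>R1 a. \<exists>w\<in>A2d ` K1 a. y = v + w"
    using residual_in_R1[of y] leading_coeff_K1[of y]
    by (intro bexI[of _ "y - A2d (N (- 2) y)"] bexI[of _ "A2d (N (- 2) y)"]) auto
qed

context
  fixes R1c K1c
  assumes R1c: "algebraic_sum (R1 a) R1c" and K1c: "direct_sum (K0 a) (K1 a) K1c"
begin

lemma R1_decomposition:
  assumes y: "y \<in> R1 a"
  defines "s \<equiv> S_ginv a R0c R1c K1c (P y)"
  shows "a 0 s = 0" "a 0 (g (y - a 1 s)) + a 1 s = y"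
proof -
  interpret R1c: algebraic_sum "R1 a" R1c by (rule R1c)
  have K1c': "csubspace K1c" "K1 a \<inter> K1c = {0}" "{v + w | v w. v \<in> K1 a \<and> w \<in> K1c} = K0 a"
    using K1c by (auto simp: direct_sum_def)
  have K1c_K0: "w \<in> K1c \<Longrightarrow> w \<in> K0 a" for w
    using K1c'(3) complex_vector.subspace_0[OF csubspace_K1[OF a_clin a_clin]] by force
  have inj: "inj_on (S_map a R0c) K1c"
  proof (rule inj_onI)
    fix u v assume uv: "u \<in> K1c" "v \<in> K1c" "S_map a R0c u = S_map a R0c v"
    then have "P (a 1 (u - v)) = 0" by (simp add: S_map_def blinfun.diff_right P_diff)
    moreover have d: "u - v \<in> K1c" using uv K1c'(1) by (intro complex_vector.subspace_diff)
    ultimately have "u - v \<in> K1 a" by (simp add: K1_def R0c.proj_eq_0_iff K1c_K0)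
    with d K1c'(2) have "u - v = 0" by blast
    then show "u = v" by simp
  qed
  have "y - P y \<in> R1 a" using R0c.proj(2) R0_subset_R1 by blast
  from complex_vector.subspace_diff[OF R1c.V y this]
  have "proj_along (R1 a) R1c (P y) = 0" by (simp add: R1c.proj_eq_0_iff)
  then have s: "s = the_inv_into K1c (S_map a R0c) (P y)" by (simp add: s_def S_ginv_def)
  obtain u h where h: "y = a 0 u + a 1 h" "h \<in> K0 a" using y by (auto simp: R1_def R0_def)
  obtain h1 h2 where h12: "h = h1 + h2" "h1 \<in> K1 a" "h2 \<in> K1c" using h(2) K1c'(3) by blast
  have "a 0 u \<in> R0 a" "a 1 h1 \<in> R0 a"
    using h12(2) by (auto simp: R0_def K1_def)
  then have "P (a 0 u) = 0" "P (a 1 h1) = 0"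
    by (simp_all add: R0c.proj_eq_0_iff)
  then have "P y = S_map a R0c h2" by (simp add: h h12 S_map_def blinfun.add_right P_add)
  with inj h12(3) have "s = h2" by (simp add: s the_inv_into_f_f)
  with \<open>P y = _\<close> have s2: "s \<in> K1c" "P y = P (a 1 s)" using h12 by (simp_all add: S_map_def)
  show "a 0 s = 0" using K1c_K0[OF s2(1)] by (simp add: K0_iff)
  show "a 0 (g (y - a 1 s)) + a 1 s = y"
    using s2 by (simp add: ginv P_diff)
qed

lemma coeff_on_R1:
  assumes y: "y \<in> R1 a" and "j \<ge> - 1"
  defines "s \<equiv> S_ginv a R0c R1c K1c (P y)"
  defines "w \<equiv> g (y - a 1 s)"
  shows "N j y = (if j = 0 then w else 0) - G j 0 w + (if j = - 1 then s else 0) - G j 1 s"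
proof -
  have "N j y = N j (a 0 w) + N j (a 1 s)"
    using R1_decomposition(2)[OF y] by (simp add: blinfun.add_right[symmetric] w_def s_def)
  also have "N j (a 0 w) = (if j = 0 then w else 0) - G j 0 w"
    using \<open>j \<ge> - 1\<close> by (simp add: left_0)
  also have "N j (a 1 s) = (if j = - 1 then s else 0) - G j 1 s"
    using \<open>j \<ge> - 1\<close> R1_decomposition(1)[OF y] by (simp add: left_1 s_def del: One_nat_def)
  finally show ?thesis by simp
qed

lemma coeff_on_A2_dagger:
  assumes t: "t \<in> K1 a" and "j \<ge> - 1"
  shows "N j (A2d t) = G j 1 (g (a 1 t)) - G j 2 t - (if j = - 1 then g (a 1 t) else 0)"
proof -
  let ?w = "g (a 1 t)"
  have "N (j + 1) (a 1 t) = N (j + 1) (a 0 ?w)" by (simp only: a0_ginv_a1[OF t])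
  moreover have "a 0 t = 0" using t by (simp add: K1_def K0_iff)
  ultimately have "N j (a 2 t) = - N (j + 1) (a 0 ?w) - G j 2 t"
    using left_2[of j t] \<open>j \<ge> - 1\<close> by simp
  then show ?thesis
    using left_1[of j ?w] \<open>j \<ge> - 1\<close> by (simp add: A2_dagger_def blinfun.diff_right)
qed

lemma coeff_split: "N j x = N j (x - A2d (N (- 2) x)) + N j (A2d (N (- 2) x))"
  by (simp add: blinfun.diff_right)

lemma coeff_nonneg:
  assumes "j \<ge> 0"
  defines "q \<equiv> \<lambda>x. x - A2d (N (- 2) x)"
  defines "s \<equiv> \<lambda>x. S_ginv a R0c R1c K1c (P (q x))"
  defines "w \<equiv> \<lambda>x. g (q x - a 1 (s x))"
  shows "N j x = G j 1 (g (a 1 (N (- 2) x))) - G j 2 (N (- 2) x)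
      + ((if j = 0 then w x else 0) - G j 0 (w x)) - G j 1 (s x)"
  using coeff_split[of j x] coeff_on_R1[OF residual_in_R1[of x], of j]
    coeff_on_A2_dagger[OF leading_coeff_K1[of x], of j] \<open>j \<ge> 0\<close>
  by (simp add: q_def s_def w_def)

lemma coeff_minus_1:
  defines "QL \<equiv> \<lambda>x. x - A2d (N (- 2) x)" and "QR \<equiv> \<lambda>x. x - N (- 2) (A2d x)"
  shows "N (- 1) x = QR (S_ginv a R0c R1c K1c (P (QL x))) - N (- 2) (a 1 (g (QL x)))
      - QR (g (a 1 (N (- 2) x))) - N (- 2) (A3d (N (- 2) x))"
proof -
  have G: "G (- 1) 0 y = N (- 2) (a 1 y)" "G (- 1) 1 y = N (- 2) (a 2 y)"
      "G (- 1) 2 y = N (- 2) (a 3 y)" for y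
    using G_second[of 0 y] G_second[of 1 y] G_second[of 2 y] by (simp_all del: One_nat_def)
  have R1: "N (- 1) y = QR (S_ginv a R0c R1c K1c (P y)) - N (- 2) (a 1 (g y))"
    if "y \<in> R1 a" for y
    using coeff_on_R1[OF that, of "- 1"]
    by (simp add: QR_def G A2_dagger_def blinfun.diff_right ginv_diff del: One_nat_def)
  have K1: "N (- 1) (A2d t) = - QR (g (a 1 t)) - N (- 2) (A3d t)" if "t \<in> K1 a" for t
    using coeff_on_A2_dagger[OF that, of "- 1"]
    by (simp add: QR_def G A2_dagger_def A3_dagger_def blinfun.diff_right del: One_nat_def)
  have "N (- 1) x = N (- 1) (QL x) + N (- 1) (A2d (N (- 2) x))"
    unfolding QL_def by (rule coeff_split)
  then show ?thesis
    using R1[OF residual_in_R1[of x]] K1[OF leading_coeff_K1[of x]] by (simp add: QL_def)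
qed

end

end

section \<open>Existence of closed complements\<close>

context inverse_coeffs
begin

text \<open>Each equation \<open>A\<^sub>0 N\<^sub>k = - (A\<^sub>1 N\<^bsub>k-1\<^esub> + \<dots>)\<close> with \<open>k < 0\<close> exhibits \<open>A\<^sub>0 N\<^sub>k\<close> as a
  finite-rank operator, and \<open>A\<^sub>0\<close> has finite-dimensional kernel.\<close>

lemma singular_coeff_finite_rank:
  assumes K0: "finite_dim (K0 a)" and "k \<ge> - int m" "k < 0"
  shows "\<exists>V. finite_dim V \<and> range (N k) \<subseteq> V"
  using assms(2,3)
proof (induction "nat (k + int m)" arbitrary: k rule: less_induct)
  case less
  have "\<exists>V. finite_dim V \<and> range (\<lambda>x. a (nat (k - i)) (N i x)) \<subseteq> V" if "i \<in> {- int m..k - 1}" for i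
  proof -
    have "\<exists>V. finite_dim V \<and> range (N i) \<subseteq> V"
      by (rule less.hyps) (use that less.prems in auto)
    then obtain V where V: "finite_dim V" "range (N i) \<subseteq> V" by blast
    then have "finite_dim (a (nat (k - i)) ` V)"
      by (intro finite_dim_image clinear_ops_linear a_clin)
    with V(2) show ?thesis by (intro exI[of _ "a (nat (k - i)) ` V"]) auto
  qed
  then have "\<exists>V. finite_dim V \<and> range (\<lambda>x. \<Sum>i\<in>{- int m..k - 1}. a (nat (k - i)) (N i x)) \<subseteq> V"
    by (intro finite_dim_sum_functions) auto
  then obtain V where V: "finite_dim V" "\<And>x. (\<Sum>i\<in>{- int m..k - 1}. a (nat (k - i)) (N i x)) \<in> V"
    by (auto simp: image_subset_iff)
  have "finite_dim (blinfun_apply (a 0) -` V)"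
    using K0 V(1) by (intro finite_dim_vimage a_clin) (auto simp: K0_def)
  moreover have "N k x \<in> blinfun_apply (a 0) -` V" for x
  proof -
    have "{- int m..k} = insert k {- int m..k - 1}" using less.prems by auto
    then have "a 0 (N k x) = - (\<Sum>i\<in>{- int m..k - 1}. a (nat (k - i)) (N i x))"
      using right[of k x] less.prems by (simp add: eq_neg_iff_add_eq_0)
    moreover have "csubspace V" using V(1) by (auto simp: finite_dim_def complex_vector.subspace_span)
    ultimately show ?thesis using V(2)[of x] by (simp add: complex_vector.subspace_neg)
  qed
  ultimately show ?case by (intro exI[of _ "blinfun_apply (a 0) -` V"]) auto
qed

lemma sum_Icc_last_0:
  fixes f :: "int \<Rightarrow> 'a"
  shows "sum f {- int m..0} = f 0 + sum f {- int m..- 1}"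
proof -
  have "{- int m..0} = insert 0 {- int m..- 1}" by auto
  then show ?thesis by simp
qed

lemma id_minus_compose_finite_rank:
  assumes K0: "finite_dim (K0 a)"
  shows "\<exists>V. finite_dim V \<and> range (id_blinfun - (N 0 o\<^sub>L a 0)) \<subseteq> V"
    and "\<exists>V. finite_dim V \<and> range (id_blinfun - (a 0 o\<^sub>L N 0)) \<subseteq> V"
proof -
  have "\<exists>V. finite_dim V \<and> range (\<lambda>x. \<Sum>k\<in>{- int m..- 1}. N k (a (nat (- k)) x)) \<subseteq> V"
  proof (intro finite_dim_sum_functions)
    fix k assume "k \<in> {- int m..- 1}"
    then obtain V where "finite_dim V" "range (N k) \<subseteq> V"
      using singular_coeff_finite_rank[OF K0, of k] by auto
    then show "\<exists>V. finite_dim V \<and> range (\<lambda>x. N k (a (nat (- k)) x)) \<subseteq> V" by blast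
  qed simp
  moreover have "(id_blinfun - (N 0 o\<^sub>L a 0)) x = (\<Sum>k\<in>{- int m..- 1}. N k (a (nat (- k)) x))" for x
    using left[of 0 x] by (simp add: sum_Icc_last_0 blinfun.diff_left algebra_simps)
  ultimately show "\<exists>V. finite_dim V \<and> range (id_blinfun - (N 0 o\<^sub>L a 0)) \<subseteq> V"
    by simp
  have "\<exists>V. finite_dim V \<and> range (\<lambda>x. \<Sum>k\<in>{- int m..- 1}. a (nat (- k)) (N k x)) \<subseteq> V"
  proof (intro finite_dim_sum_functions)
    fix k assume "k \<in> {- int m..- 1}"
    then obtain V where V: "finite_dim V" "range (N k) \<subseteq> V"
      using singular_coeff_finite_rank[OF K0, of k] by auto
    then have "finite_dim (a (nat (- k)) ` V)"
      by (intro finite_dim_image clinear_ops_linear a_clin)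
    with V(2) show "\<exists>V. finite_dim V \<and> range (\<lambda>x. a (nat (- k)) (N k x)) \<subseteq> V"
      by (intro exI[of _ "a (nat (- k)) ` V"]) auto
  qed simp
  moreover have "(id_blinfun - (a 0 o\<^sub>L N 0)) x = (\<Sum>k\<in>{- int m..- 1}. a (nat (- k)) (N k x))" for x
    using right[of 0 x] by (simp add: sum_Icc_last_0 blinfun.diff_left algebra_simps)
  ultimately show "\<exists>V. finite_dim V \<and> range (id_blinfun - (a 0 o\<^sub>L N 0)) \<subseteq> V"
    by simp
qed

lemma id_minus_compose_clinear:
  "id_blinfun - (N 0 o\<^sub>L a 0) \<in> clinear_ops" "id_blinfun - (a 0 o\<^sub>L N 0) \<in> clinear_ops"
  using clinear_ops_scaleC[OF a_clin] clinear_ops_scaleC[OF N_clin[of 0]]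
  by (auto intro!: clinear_opsI simp: blinfun.diff_left complex_vector.scale_right_diff_distrib)

lemma closed_superspace_R0:
  assumes "finite_dim (K0 a)" "csubspace W" "R0 a \<subseteq> W"
  shows "closed W"
proof -
  obtain V where V: "finite_dim V" "range (id_blinfun - (a 0 o\<^sub>L N 0)) \<subseteq> V"
    using id_minus_compose_finite_rank(2)[OF assms(1)] by blast
  have "op_kernel (id_blinfun - (a 0 o\<^sub>L N 0)) \<subseteq> W"
  proof
    fix x assume "x \<in> op_kernel (id_blinfun - (a 0 o\<^sub>L N 0))"
    then have "x = a 0 (N 0 x)" by (simp add: op_kernel_def blinfun.diff_left)
    then have "x \<in> R0 a" unfolding R0_def by (metis rangeI)
    with assms(3) show "x \<in> W" by blast
  qed
  then show ?thesis
    using closed_if_contains_finite_rank_kernel[OF id_minus_compose_clinear(2) V assms(2)] by blast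
qed

lemma complement_K0_exists:
  assumes K0: "finite_dim (K0 a)"
  shows "\<exists>K0c. complementary (K0 a) K0c"
proof -
  let ?T = "id_blinfun - (N 0 o\<^sub>L a 0)"
  obtain V where V: "finite_dim V" "range ?T \<subseteq> V"
    using id_minus_compose_finite_rank(1)[OF K0] by blast
  have K0s: "csubspace (K0 a)" by (intro csubspace_K0 a_clin)
  have Ts: "csubspace (op_kernel ?T)" by (intro csubspace_op_kernel id_minus_compose_clinear)
  let ?S = "{x + y | x y. x \<in> K0 a \<and> y \<in> op_kernel ?T}"
  have "csubspace ?S" using K0s Ts by (rule complex_vector.subspace_sums)
  from complement_within_exists[OF this complex_vector.subspace_UNIV subset_UNIV]
  obtain C where C: "csubspace C" "?S \<inter> C = {0}" "\<forall>x\<in>UNIV. \<exists>v\<in>?S. \<exists>c\<in>C. x = v + c"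
    by blast
  define K0c where "K0c = {x + y | x y. x \<in> op_kernel ?T \<and> y \<in> C}"
  have K0cs: "csubspace K0c" unfolding K0c_def using Ts C(1) by (rule complex_vector.subspace_sums)
  have sub: "op_kernel ?T \<subseteq> K0c"
    using complex_vector.subspace_0[OF C(1)] by (force simp: K0c_def)
  have Int: "x = 0" if "x \<in> K0 a" "x \<in> K0c" for x
  proof -
    obtain y c where yc: "x = y + c" "y \<in> op_kernel ?T" "c \<in> C" using \<open>x \<in> K0c\<close> by (auto simp: K0c_def)
    have "- y \<in> op_kernel ?T" using Ts yc(2) by (rule complex_vector.subspace_neg)
    moreover have "c = x + - y" using yc(1) by simp
    ultimately have "c \<in> ?S" using that(1) by blast
    with C(2) yc(3) have "c = 0" by blast
    with yc have "?T x = 0" by (simp add: op_kernel_def)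
    with that(1) show "x = 0" by (simp add: blinfun.diff_left K0_iff)
  qed
  have "algebraic_sum (K0 a) K0c"
  proof
    show "K0 a \<inter> K0c = {0}"
      using Int complex_vector.subspace_0[OF K0s] complex_vector.subspace_0[OF K0cs] by auto
    fix x
    obtain v c where vc: "v \<in> ?S" "c \<in> C" "x = v + c" using C(3) by blast
    then obtain k y where "v = k + y" "k \<in> K0 a" "y \<in> op_kernel ?T" by blast
    with vc show "\<exists>v\<in>K0 a. \<exists>w\<in>K0c. x = v + w"
      by (intro bexI[of _ k] bexI[of _ "y + c"]) (auto simp: K0c_def add.assoc)
  qed fact+
  moreover have "closed (K0 a)" using K0 by (rule closed_finite_dim)
  moreover have "closed K0c"
    using closed_if_contains_finite_rank_kernel[OF id_minus_compose_clinear(1) V K0cs sub] .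
  ultimately show ?thesis unfolding complementary_iff by blast
qed

lemma complements_R0_R1_exist:
  assumes K0: "finite_dim (K0 a)" and R0: "finite_codim (R0 a)"
  shows "\<exists>R0c R1c. complementary (R0 a) R0c \<and> complementary (R1 a) R1c \<and> R1c \<subseteq> R0c"
proof -
  have R0s: "csubspace (R0 a)" and R1s: "csubspace (R1 a)"
    by (intro csubspace_R0 csubspace_R1 a_clin)+
  from complement_within_exists[OF R0s complex_vector.subspace_UNIV subset_UNIV]
  obtain R0c where R0c: "csubspace R0c" "R0 a \<inter> R0c = {0}" "\<forall>x\<in>UNIV. \<exists>v\<in>R0 a. \<exists>c\<in>R0c. x = v + c"
    by blast
  interpret R0c: algebraic_sum "R0 a" R0c using R0s R0c by unfold_locales auto
  have fin: "finite_dim R0c" using R0 by (rule R0c.finite_dim_if_finite_codim)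
  have "csubspace (R1 a \<inter> R0c)" using R1s R0c(1) by (rule complex_vector.subspace_inter)
  from complement_within_exists[OF this R0c(1) Int_lower2]
  obtain R1c where R1c: "csubspace R1c" "R1c \<subseteq> R0c" "R1 a \<inter> R0c \<inter> R1c = {0}"
      "\<forall>x\<in>R0c. \<exists>v\<in>R1 a \<inter> R0c. \<exists>c\<in>R1c. x = v + c"
    by blast
  have "algebraic_sum (R1 a) R1c"
  proof
    show "R1 a \<inter> R1c = {0}" using R1c(2,3) by blast
    fix x
    obtain u c where u: "u \<in> R0 a" "c \<in> R0c" "x = u + c" using R0c(3) by blast
    obtain v d where v: "v \<in> R1 a" "d \<in> R1c" "c = v + d" using R1c(4) u(2) by blast
    have "u + v \<in> R1 a"
      using u(1) v(1) R0_subset_R1 by (intro complex_vector.subspace_add[OF R1s]) auto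
    with u v show "\<exists>v\<in>R1 a. \<exists>w\<in>R1c. x = v + w"
      by (intro bexI[of _ "u + v"] bexI[of _ d]) (auto simp: add.assoc)
  qed fact+
  moreover have "closed R0c" "closed R1c"
    using fin finite_dim_subset[OF fin R1c(1,2)] by (auto intro: closed_finite_dim)
  moreover have "closed (R0 a)" "closed (R1 a)"
    using K0 R0s R1s R0_subset_R1 by (auto intro: closed_superspace_R0)
  ultimately show ?thesis
    using R1c(2) R0c.algebraic_sum_axioms unfolding complementary_iff by blast
qed

end

theorem proposition3p2:
  fixes U :: "complex set"
    and A :: "complex \<Rightarrow> ('a::complex_banach \<Rightarrow>\<^sub>L 'a)"
    and z\<^sub>0 :: complex
    and a :: "nat \<Rightarrow> ('a \<Rightarrow>\<^sub>L 'a)"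
    and N :: "int \<Rightarrow> ('a \<Rightarrow>\<^sub>L 'a)"
    and m :: nat
  assumes separable: "separable_space (euclidean :: 'a topology)"
    and U: "open U" "connected U"
    and pencil: "fredholm_pencil A U"
    and z0: "z\<^sub>0 isolated_in pencil_spectrum A U"
    and taylor: "\<forall>j. a j \<in> clinear_ops" "has_taylor_series A z\<^sub>0 a"
    and laurent: "\<forall>j\<ge>- int m. N j \<in> clinear_ops" "has_laurent_series (\<lambda>z. op_inverse (A z)) z\<^sub>0 m N"
    and m: "m \<ge> 1" "N (- int m) \<noteq> 0"
    and K1: "K1 a \<noteq> {0}"
  shows
    "(m = 2 \<longleftrightarrow>
       (\<exists>R0c K0c. complementary (R0 a) R0c \<and> complementary (K0 a) K0c \<and>
          direct_sum UNIV (R1 a) (A2_dagger a R0c K0c ` K1 a)))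
     \<and>
     (m = 2 \<longleftrightarrow>
       (\<forall>R0c K0c R1c. complementary (R0 a) R0c \<and> complementary (K0 a) K0c \<and>
          complementary (R1 a) R1c \<and> R1c \<subseteq> R0c \<longrightarrow>
          bij_betw (S_dagger a R0c K0c R1c) (K1 a) R1c))
     \<and>
     (m = 2 \<longleftrightarrow>
       (\<exists>R0c K0c R1c. complementary (R0 a) R0c \<and> complementary (K0 a) K0c \<and>
          complementary (R1 a) R1c \<and> R1c \<subseteq> R0c \<and>
          bij_betw (S_dagger a R0c K0c R1c) (K1 a) R1c))
     \<and>
     (m = 2 \<longrightarrow>
       (\<forall>R0c K0c R1c K1c. complementary (R0 a) R0c \<and> complementary (K0 a) K0c \<and>
          complementary (R1 a) R1c \<and> R1c \<subseteq> R0c \<and> direct_sum (K0 a) (K1 a) K1c \<longrightarrow>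
          (let A0g = A0_ginv a R0c K0c;
               Sg = S_ginv a R0c R1c K1c;
               PR0c = proj_along (R0 a) R0c;
               PR1c = proj_along (R1 a) R1c;
               A2d = A2_dagger a R0c K0c;
               A3d = A3_dagger a R0c K0c;
               QL = (\<lambda>x. x - A2d (N (- 2) x));
               QR = (\<lambda>x. x - N (- 2) (A2d x));
               G = (\<lambda>j l. G_sum a N j l 2)
           in (\<forall>x. N (- 2) x = the_inv_into (K1 a) (S_dagger a R0c K0c R1c) (PR1c x))
            \<and> (\<forall>x. N (- 1) x =
                QR (Sg (PR0c (QL x))) - N (- 2) (a 1 (A0g (QL x)))
                - QR (A0g (a 1 (N (- 2) x))) - N (- 2) (A3d (N (- 2) x)))
            \<and> (\<forall>j\<ge>0. \<forall>x. N j x =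
                G j 1 (A0g (a 1 (N (- 2) x))) - G j 2 (N (- 2) x)
                + (let y = A0g (QL x - a 1 (Sg (PR0c (QL x))))
                   in (if j = 0 then y else 0) - G j 0 y)
                - G j 1 (Sg (PR0c (QL x)))))))"
proof -
  have z0U: "z\<^sub>0 \<in> U" using z0 by (auto simp: isolated_in_def pencil_spectrum_def)
  interpret inverse_coeffs a N m
    using taylor(1) laurent(1) inverse_laurent_coeffs[OF U(1) pencil z0 taylor laurent]
    by unfold_locales auto
  have "A z\<^sub>0 = a 0"
  proof -
    obtain r where "r > 0" "\<forall>z\<in>ball z\<^sub>0 r. (\<lambda>j. (z - z\<^sub>0) ^ j *\<^sub>C a j) sums A z"
      using taylor(2) unfolding has_taylor_series_def by blast
    then have "(\<lambda>j. (z\<^sub>0 - z\<^sub>0) ^ j *\<^sub>C a j) sums A z\<^sub>0" by (metis centre_in_ball)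
    moreover have "(\<lambda>j. (z\<^sub>0 - z\<^sub>0) ^ j *\<^sub>C a j) sums a 0"
      using sums_single[of 0 a] by (rule sums_cong[THEN iffD1, rotated]) (auto simp: scaleC_one power_0_left)
    ultimately show ?thesis by (rule sums_unique2)
  qed
  moreover have "fredholm_op (A z\<^sub>0)" using pencil z0U by (simp add: fredholm_pencil_def)
  ultimately have K0: "finite_dim (K0 a)" and R0: "finite_codim (R0 a)"
    by (simp_all add: fredholm_op_def K0_def R0_def)
  have m2: "m \<ge> 2" using m(1) K1 by (rule pole_order_ge_2)
  have choice: "inverse_coeffs_complements a N m R0c K0c"
    if "complementary (R0 a) R0c" "complementary (K0 a) K0c" for R0c K0c
    using that taylor(1) inverse_coeffs_axioms
    by (simp add: inverse_coeffs_complements_def complements_def complementary_iff)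
  have double: "double_pole_complements a N R0c K0c"
    if "m = 2" "complementary (R0 a) R0c" "complementary (K0 a) K0c" for R0c K0c
    using choice[OF that(2,3)] that(1) by (simp add: double_pole_complements_def)
  obtain R0c K0c R1c where ex: "complementary (R0 a) R0c" "complementary (K0 a) K0c"
      "complementary (R1 a) R1c" "R1c \<subseteq> R0c"
    using complement_K0_exists[OF K0] complements_R0_R1_exist[OF K0 R0] by blast
  have fwd_ii: "direct_sum UNIV (R1 a) (A2_dagger a R0c K0c ` K1 a)" if "m = 2"
  proof -
    interpret D: double_pole_complements a N R0c K0c using that ex(1,2) by (rule double)
    have "finite_dim (K1 a)"
      using K0 csubspace_K1[OF a_clin a_clin] by (rule finite_dim_subset) (auto simp: K1_def)
    then have "closed (A2_dagger a R0c K0c ` K1 a)"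
      by (intro closed_finite_dim finite_dim_image D.A2_dagger_linear)
    with ex(3) D.R1_A2_dagger_K1_sum show ?thesis by (simp add: complementary_iff)
  qed
  have bwd_ii: "m = 2" if "complementary (R0 a) R0c" "complementary (K0 a) K0c"
      "direct_sum UNIV (R1 a) (A2_dagger a R0c K0c ` K1 a)" for R0c K0c
  proof -
    interpret C: inverse_coeffs_complements a N m R0c K0c using that(1,2) by (rule choice)
    interpret S: algebraic_sum "R1 a" "A2_dagger a R0c K0c ` K1 a"
      using that(3) by (simp add: complementary_iff)
    show ?thesis
    proof (rule C.pole_order_eq_2_if_spanning[OF m2 m(2)])
      fix y
      obtain v x where "v \<in> R1 a" "x \<in> K1 a" "y = v + A2_dagger a R0c K0c x"
        using S.decomp[of y] by blast
      then show "\<exists>x\<in>K1 a. y - A2_dagger a R0c K0c x \<in> R1 a" by (intro bexI[of _ x]) auto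
    qed
  qed
  have fwd_iii: "bij_betw (S_dagger a R0c K0c R1c) (K1 a) R1c"
    if "m = 2" "complementary (R0 a) R0c" "complementary (K0 a) K0c" "complementary (R1 a) R1c"
    for R0c K0c R1c
    using double_pole_complements.S_dagger_bij(1)[OF double[OF that(1-3)]] that(4)
    by (simp add: complementary_iff)
  have bwd_iv: "m = 2"
    if "complementary (R0 a) R0c" "complementary (K0 a) K0c" "complementary (R1 a) R1c"
      "bij_betw (S_dagger a R0c K0c R1c) (K1 a) R1c" for R0c K0c R1c
    using inverse_coeffs_complements.pole_order_eq_2_if_bij[OF choice[OF that(1,2)] m2 m(2) _ that(4)] that(3)
    by (simp add: complementary_iff)
  have alg: "algebraic_sum V W" if "complementary V W" for V W :: "'a set"
    using that by (simp add: complementary_iff)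
  show ?thesis
  proof (intro conjI)
    show "m = 2 \<longleftrightarrow> (\<exists>R0c K0c. complementary (R0 a) R0c \<and> complementary (K0 a) K0c \<and>
        direct_sum UNIV (R1 a) (A2_dagger a R0c K0c ` K1 a))"
      using fwd_ii bwd_ii ex(1,2) by blast
    show "m = 2 \<longleftrightarrow> (\<forall>R0c K0c R1c. complementary (R0 a) R0c \<and> complementary (K0 a) K0c \<and>
        complementary (R1 a) R1c \<and> R1c \<subseteq> R0c \<longrightarrow> bij_betw (S_dagger a R0c K0c R1c) (K1 a) R1c)"
      using fwd_iii bwd_iv ex by blast
    show "m = 2 \<longleftrightarrow> (\<exists>R0c K0c R1c. complementary (R0 a) R0c \<and> complementary (K0 a) K0c \<and>
        complementary (R1 a) R1c \<and> R1c \<subseteq> R0c \<and> bij_betw (S_dagger a R0c K0c R1c) (K1 a) R1c)"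
      using fwd_iii bwd_iv ex by blast
  qed (unfold Let_def, intro impI allI, elim conjE, intro conjI allI impI,
      (rule double_pole_complements.S_dagger_bij(2)[OF double alg]; assumption),
      (rule double_pole_complements.coeff_minus_1[OF double alg]; assumption),
      (rule double_pole_complements.coeff_nonneg[OF double alg]; assumption))
qed

end
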